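(* Let $n>m>1$ be integers and $\mathrm{BS}(m,n)=\langle a,b : ab^ma^{-1}=b^n\rangle$. Then no subgroup of $\mathrm{Diff}^2_+([0,1])$ is isomorphic to $\mathrm{BS}(m,n)$. If moreover $m$ does not divide $n$, then no subgroup of $\mathrm{Diff}^2_+(S^1)$ is isomorphic to $\mathrm{BS}(m,n)$.
   Context: $\mathrm{Diff}^2_+(M)$ denotes the group of orientation-preserving $C^2$ diffeomorphisms of $M$. *)

theory Defs
  imports "HOL-Analysis.Analysis"
begin

text \<open>A letter is (generator, sign): generator True = a, False = b;
  sign True = exponent +1, False = exponent -1.\<close>

type_synonym letter = "bool \<times> bool"
type_synonym word = "letter list"

definition bs_relator :: "nat \<Rightarrow> nat \<Rightarrow> word" where
  "bs_relator m n =
     [(True, True)] @ replicate m (False, True) @ [(True, False)] @ replicate n (False, False)"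

inductive bs_eq :: "nat \<Rightarrow> nat \<Rightarrow> word \<Rightarrow> word \<Rightarrow> bool" for m n where
  bs_refl: "bs_eq m n w w"
| bs_sym: "bs_eq m n u w \<Longrightarrow> bs_eq m n w u"
| bs_trans: "bs_eq m n u v \<Longrightarrow> bs_eq m n v w \<Longrightarrow> bs_eq m n u w"
| bs_cancel: "bs_eq m n (u @ [(g, s), (g, \<not> s)] @ v) (u @ v)"
| bs_rel: "bs_eq m n (u @ bs_relator m n @ v) (u @ v)"

fun eval_word :: "'x set \<Rightarrow> (bool \<Rightarrow> 'x \<Rightarrow> 'x) \<Rightarrow> word \<Rightarrow> 'x \<Rightarrow> 'x" where
  "eval_word X h [] = id"
| "eval_word X h ((g, True) # w) = h g \<circ> eval_word X h w"
| "eval_word X h ((g, False) # w) = inv_into X (h g) \<circ> eval_word X h w"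

text \<open>The subgroup generated by f (image of a) and g (image of b) is isomorphic to
  BS(m,n) via a |-> f, b |-> g exactly when a word evaluates to the identity of X iff it is
  trivial in BS(m,n).\<close>

definition faithful_BS :: "nat \<Rightarrow> nat \<Rightarrow> 'x set \<Rightarrow> ('x \<Rightarrow> 'x) \<Rightarrow> ('x \<Rightarrow> 'x) \<Rightarrow> bool" where
  "faithful_BS m n X f g \<longleftrightarrow>
     (\<forall>w. (\<forall>x\<in>X. eval_word X (\<lambda>c. if c then f else g) w x = x) \<longleftrightarrow> bs_eq m n w [])"

definition C2_on :: "real set \<Rightarrow> (real \<Rightarrow> real) \<Rightarrow> bool" where
  "C2_on S f \<longleftrightarrow> (\<exists>f1 f2.
     (\<forall>x\<in>S. (f has_real_derivative f1 x) (at x within S)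
           \<and> (f1 has_real_derivative f2 x) (at x within S))
     \<and> continuous_on S f2)"

definition Diff2_interval :: "(real \<Rightarrow> real) set" where
  "Diff2_interval = {f. bij_betw f {0..1} {0..1} \<and> C2_on {0..1} f
       \<and> C2_on {0..1} (inv_into {0..1} f) \<and> strict_mono_on {0..1} f}"

text \<open>S^1 is the unit circle in the complex plane; an orientation-preserving C^2 diffeomorphism
  of S^1 is a map of the circle admitting a lift F to R (h(e^{2 pi i t}) = e^{2 pi i F(t)})
  which is an increasing C^2 diffeomorphism of R commuting with integer translation.\<close>

definition circle :: "complex set" where
  "circle = sphere 0 1"

definition Diff2_circle :: "(complex \<Rightarrow> complex) set" where
  "Diff2_circle = {h. bij_betw h circle circle \<and>
     (\<exists>F G. C2_on UNIV F \<and> C2_on UNIV G \<and> (\<forall>t. G (F t) = t \<and> F (G t) = t)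
        \<and> strict_mono F \<and> (\<forall>t. F (t + 1) = F t + 1)
        \<and> (\<forall>t. h (cis (2 * pi * t)) = cis (2 * pi * F t)))}"

end

theory Submission
  imports Defs
begin

text \<open>Let \<open>f g ^ m f\<inverse> = g ^ n\<close>. If \<open>u\<close> is a power of \<open>g\<close> (up to translation of a lift) that has fixed
  points, then \<open>v = f u f\<inverse>\<close> satisfies \<open>v ^ m = u ^ n\<close>, so both commute with \<open>h = u ^ n\<close>. On a component of the
  complement of the fixed points of \<open>u\<close>, the commutator of \<open>u\<close> and \<open>v\<close> must fix some point, and by Kopell's lemma
  an element of the centraliser of \<open>h\<close> with a fixed point is the identity there; hence \<open>u\<close> and \<open>v\<close> commute.
  On the interval one takes \<open>u = g\<close>. On the circle a comparison of rotation numbers shows that \<open>g ^ (n - m)\<close> has a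
  fixed point. So \<open>a b ^ p a\<inverse>\<close> and \<open>b ^ p\<close> have commuting images, for \<open>p = 1\<close> respectively \<open>p = n - m\<close>, although they
  do not commute in \<open>BS(m, n)\<close>, as an explicit action on \<open>\<int> \<times> \<int>\<close> shows.\<close>

section \<open>Words in Baumslag--Solitar groups\<close>

lemma eval_word_append: "eval_word X h (u @ v) = eval_word X h u \<circ> eval_word X h v"
proof (induction u)
  case (Cons l u)
  obtain g s where "l = (g, s)" by (cases l)
  then show ?case using Cons by (cases s) (auto simp: comp_assoc)
qed simp

lemma eval_word_replicate_True:
  "eval_word X h (replicate k (g, True)) = h g ^^ k"
  by (induction k) auto

lemma eval_word_replicate_False:
  "eval_word X h (replicate k (g, False)) = inv_into X (h g) ^^ k"
  by (induction k) auto

lemmas eval_word_simps = eval_word_append eval_word_replicate_True eval_word_replicate_False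

text \<open>Words are transported along equivariant maps: the inclusion of the interval into the
  line, the covering of the circle by the line, the translation by 1, and the inclusion of a single
  fixed point.\<close>

lemma eval_word_semiconj:
  assumes H: "\<And>c. bij_betw (H c) Y Y" and h: "\<And>c. bij_betw (h c) X X"
    and \<pi>: "\<And>y. y \<in> Y \<Longrightarrow> \<pi> y \<in> X"
    and eq: "\<And>c y. y \<in> Y \<Longrightarrow> h c (\<pi> y) = \<pi> (H c y)"
    and y: "y \<in> Y"
  shows "eval_word Y H w y \<in> Y \<and> eval_word X h w (\<pi> y) = \<pi> (eval_word Y H w y)"
proof (induction w)
  case (Cons l w)
  obtain g s where l: "l = (g, s)" by (cases l)
  let ?z = "eval_word Y H w y"
  have z: "?z \<in> Y" and IH: "eval_word X h w (\<pi> y) = \<pi> ?z" using Cons by auto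
  show ?case
  proof (cases s)
    case True
    then show ?thesis using z IH l eq[OF z, of g] H[of g] by (auto simp: bij_betw_def)
  next
    case False
    let ?x = "inv_into Y (H g) ?z"
    have x: "?x \<in> Y" "H g ?x = ?z"
      using H[of g] z by (auto simp: bij_betw_def inv_into_into f_inv_into_f)
    have "inv_into X (h g) (\<pi> ?z) = \<pi> ?x"
      using eq[OF x(1), of g] x h[of g] \<pi>[OF x(1)] by (intro inv_into_f_eq) (auto simp: bij_betw_def)
    then show ?thesis using False l x IH by simp
  qed
qed (use y in simp)

lemma eval_word_bs_eq:
  assumes "bs_eq m n u w" and bij: "\<And>c. bij (h c)"
    and rel: "eval_word UNIV h (bs_relator m n) = id"
  shows "eval_word UNIV h u = eval_word UNIV h w"
  using assms(1)
proof induction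
  case (bs_cancel u g s v)
  have "eval_word UNIV h [(g, s), (g, \<not> s)] = id"
    using bij[of g] by (cases s) (auto simp: fun_eq_iff bij_is_inj bij_is_surj surj_f_inv_f)
  then show ?case by (simp only: eval_word_append) auto
next
  case (bs_rel u v)
  then show ?case using rel by (simp only: eval_word_append) auto
qed auto

section \<open>Commutator words and the relator\<close>

definition conj_word :: "nat \<Rightarrow> word" where
  "conj_word p = (True, True) # replicate p (False, True) @ [(True, False)]"

text \<open>The commutator of \<open>a b^p a^-1\<close> and \<open>b^p\<close>, with the inverse of
  the former multiplied out.\<close>

definition comm_word :: "nat \<Rightarrow> word" where
  "comm_word p = conj_word p @ replicate p (False, True)
     @ (True, True) # replicate p (False, False) @ [(True, False)] @ replicate p (False, False)"

lemma eval_comm_word: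
  assumes F: "bij F" and G: "bij G"
    and comm: "\<And>t. F ((G ^^ p) (inv F ((G ^^ p) t))) = (G ^^ p) (F ((G ^^ p) (inv F t)))"
  shows "eval_word UNIV (\<lambda>c. if c then F else G) (comm_word p) t = t"
proof -
  have i: "F (inv F t) = t" "inv F (F t) = t" "(G ^^ p) ((inv G ^^ p) t) = t" for t
    using F G by (simp_all add: bij_is_surj surj_f_inv_f bij_is_inj bij_fn flip: inv_fn)
  show ?thesis by (simp add: comm_word_def conj_word_def eval_word_simps comm i)
qed

text \<open>Starting at \<open>(G ^^ n) t\<close> cancels the trailing \<open>b^-n\<close>, so a
  trivially acting relator becomes \<open>F G^m F^-1 = G^n\<close>. The same formula serves lifts,
  whose relator acts as a translation.\<close>

lemma eval_bs_relator:
  assumes F: "bij F" and G: "bij G"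
  shows "eval_word UNIV (\<lambda>c. if c then F else G) (bs_relator m n) ((G ^^ n) t) = F ((G ^^ m) (inv F t))"
proof -
  have "(inv G ^^ n) ((G ^^ n) t) = t" for t
    using G by (simp add: bij_is_inj bij_fn flip: inv_fn)
  then show ?thesis by (simp add: bs_relator_def eval_word_simps)
qed

lemma faithful_BS_relator:
  assumes "faithful_BS m n X f g" "x \<in> X"
  shows "eval_word X (\<lambda>c. if c then f else g) (bs_relator m n) x = x"
  using assms bs_rel[of m n "[]" "[]"] unfolding faithful_BS_def by auto

lemma eval_word_fixed:
  assumes "\<And>c. bij (h c)" "\<And>c. h c y = y"
  shows "eval_word UNIV h w y = y"
  using eval_word_semiconj[of h "{y}" h UNIV "\<lambda>y. y" y w] assms by simp

lemma strict_mono_inv: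
  fixes u :: "'a::linorder \<Rightarrow> 'a"
  assumes "strict_mono u" "bij u"
  shows "strict_mono (inv u)"
  using assms by (metis bij_inv_eq_iff strict_mono_def strict_mono_less)

lemma eval_word_strict_mono:
  fixes h :: "bool \<Rightarrow> 'a::linorder \<Rightarrow> 'a"
  assumes "\<And>c. bij (h c)" "\<And>c. strict_mono (h c)"
  shows "strict_mono (eval_word UNIV h w)"
proof (induction w)
  case (Cons l w)
  obtain g s where l: "l = (g, s)" by (cases l)
  have "strict_mono (h g \<circ> eval_word UNIV h w)" "strict_mono (inv (h g) \<circ> eval_word UNIV h w)"
    using Cons assms by (auto intro: strict_mono_o strict_mono_inv)
  then show ?case unfolding l by (cases s) (simp_all add: comp_def)
qed (simp add: strict_mono_def)

text \<open>The action on \<open>\<int> \<times> \<int>\<close>: \<open>b\<close> shifts the first coordinate. The orbits of \<open>b ^ m\<close> are indexed by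
  \<open>(r, i)\<close> with \<open>0 \<le> r < m\<close>, hence by the integer \<open>m * i + r\<close>, and likewise for \<open>b ^ n\<close>; \<open>a\<close> carries the orbit of
  \<open>b ^ m\<close> with index \<open>k\<close> to the orbit of \<open>b ^ n\<close> with index \<open>k + s\<close>. The offset \<open>s\<close> is free and is chosen so that
  the two sides of the commutation relation move the origin to different lines.\<close>

definition bs_transfer :: "int \<Rightarrow> int \<Rightarrow> int \<Rightarrow> int \<times> int \<Rightarrow> int \<times> int" where
  "bs_transfer m n s = (\<lambda>(x, i). (n * (x div m) + (m * i + x mod m + s) mod n,
     (m * i + x mod m + s) div n))"

lemma bs_transfer_inverse:
  assumes "m > 0" "n > 0"
  shows "bs_transfer n m (- s) (bs_transfer m n s z) = z"
proof -
  obtain x i where z: "z = (x, i)" by (cases z)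
  \<comment> \<open>The index of the target orbit. Its quotient and remainder by \<open>n\<close>
    are stored in the image, so the inverse can rebuild \<open>k\<close> and subtract
    \<open>s\<close>.\<close>
  define k where "k = m * i + x mod m + s"
  have 1: "(n * (x div m) + k mod n) mod n = k mod n" "(n * (x div m) + k mod n) div n = x div m"
    using assms by auto
  have 2: "n * (k div n) + k mod n = k" by simp
  have 3: "k - s = m * i + x mod m" by (simp add: k_def)
  have "bs_transfer n m (- s) (bs_transfer m n s z)
    = (m * (x div m) + (k - s) mod m, (k - s) div m)"
    unfolding z bs_transfer_def using 1 2 by (simp flip: k_def)
  then show ?thesis using assms unfolding 3 z by simp
qed

lemma bij_bs_transfer:
  assumes "m > 0" "n > 0"
  shows "bij (bs_transfer m n s)" "inv (bs_transfer m n s) = bs_transfer n m (- s)"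
proof -
  have "bs_transfer m n s \<circ> bs_transfer n m (- s) = id" "bs_transfer n m (- s) \<circ> bs_transfer m n s = id"
    using bs_transfer_inverse[OF assms, of s] bs_transfer_inverse[OF assms(2,1), of "- s"]
    by (auto simp: fun_eq_iff)
  then show "bij (bs_transfer m n s)" "inv (bs_transfer m n s) = bs_transfer n m (- s)"
    by (auto intro: o_bij inv_unique_comp)
qed

definition bs_shift :: "int \<times> int \<Rightarrow> int \<times> int" where
  "bs_shift = (\<lambda>(x, i). (x + 1, i))"

lemma bij_bs_shift: "bij bs_shift"
  by (rule o_bij[where g = "\<lambda>(x, i). (x - 1, i)"]) (auto simp: fun_eq_iff bs_shift_def)

lemma bs_shift_funpow: "(bs_shift ^^ k) (x, i) = (x + int k, i)"
  by (induction k) (auto simp: bs_shift_def)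

text \<open>Adding \<open>m\<close> to the first coordinate raises its quotient by \<open>m\<close>
  by one and keeps the orbit index; this gives the defining relation
  \<open>a b^m = b^n a\<close>.\<close>

lemma bs_transfer_shift:
  assumes "m > 0"
  shows "bs_transfer (int m) (int n) s ((bs_shift ^^ m) z) = (bs_shift ^^ n) (bs_transfer (int m) (int n) s z)"
  using assms by (cases z) (simp add: bs_shift_funpow bs_transfer_def algebra_simps)

lemma comm_word_nontrivial:
  assumes "0 < m" "0 < p" "p < n" "\<not> m dvd p"
  shows "\<not> bs_eq m n (comm_word p) []"
proof
  assume eq: "bs_eq m n (comm_word p) []"
  define r where "r = int (p mod m)"
  define q where "q = int (p div m)"
  have p: "int p = int m * q + r" unfolding r_def q_def by (metis of_nat_add of_nat_mult mult_div_mod_eq)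
  have r: "0 < r" "r < int m" using assms by (auto simp: r_def dvd_eq_mod_eq_0)
  have q: "0 \<le> q" by (simp add: q_def)
  \<comment> \<open>On one side of the commutation \<open>A\<close> is last applied to a point of
    orbit index 0, giving index \<open>r - m < 0\<close>; on the other to one of index
    \<open>m * (q + 1) + r\<close>, giving \<open>m * q + 2 * r\<close>, which is nonnegative. The
    sign of the index decides the sign of the line.\<close>
  define A where "A = bs_transfer (int m) (int n) (r - int m)"
  define A' where "A' = bs_transfer (int n) (int m) (int m - r)"
  define B where "B = bs_shift"
  have n: "n > 0" using assms by simp
  have A: "bij A" "inv A = A'" and B: "bij B"
    using bij_bs_transfer[of "int m" "int n" "r - int m"] bij_bs_shift n assms
    unfolding A_def A'_def B_def by auto
  have AA: "A' (A z) = z" "A (A' z) = z" for z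
    using A by (metis bij_inv_eq_iff)+
  define h where "h = (\<lambda>c. if c then A else B)"
  have bij: "bij (h c)" for c using A B by (simp add: h_def)
  have Bi: "(B ^^ k) ((inv B ^^ k) z) = z" "(inv B ^^ k) ((B ^^ k) z) = z" for k z
    using B by (simp_all flip: inv_fn) (simp_all add: bij_fn surj_f_inv_f bij_is_surj bij_is_inj)
  have "eval_word UNIV h (bs_relator m n) z = z" for z
  proof -
    have "A ((B ^^ m) (A' w)) = (B ^^ n) w" for w
      using bs_transfer_shift[of m n "r - int m" "A' w"] assms AA unfolding A_def[symmetric] B_def by simp
    then show ?thesis
      by (simp add: bs_relator_def eval_word_simps h_def A Bi)
  qed
  then have "eval_word UNIV h (comm_word p) = id"
    using eval_word_bs_eq[OF eq bij] by (simp add: fun_eq_iff)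
  \<comment> \<open>From this starting point the two inverse factors of the commutator cancel, which
    leaves the images of the origin under the two products to compare.\<close>
  then have "eval_word UNIV h (comm_word p) ((B ^^ p) (A ((B ^^ p) (A' (0, 0))))) = (B ^^ p) (A ((B ^^ p) (A' (0, 0))))"
    by simp
  then have eq2: "A ((B ^^ p) (A' ((B ^^ p) (0, 0)))) = (B ^^ p) (A ((B ^^ p) (A' (0, 0))))"
    by (simp add: comm_word_def conj_word_def eval_word_simps h_def A Bi AA)
  have k: "int p + (int m - r) = int m * (q + 1)" by (simp add: p algebra_simps)
  \<comment> \<open>Here \<open>p < n\<close> gives \<open>p mod n = p\<close> and
    \<open>p div n = 0\<close>.\<close>
  have "A' ((B ^^ p) (0, 0)) = (0, q + 1)"
    using assms r unfolding A'_def B_def bs_shift_funpow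
    by (simp add: bs_transfer_def k del: distrib_left_numeral)
  then have 1: "A ((B ^^ p) (A' ((B ^^ p) (0, 0)))) = A (int p, q + 1)"
    by (simp add: B_def bs_shift_funpow)
  have "int p mod int m = r" by (simp add: r_def of_nat_mod)
  then have "int m * (q + 1) + int p mod int m + (r - int m) \<ge> 0"
    using q r by (simp add: algebra_simps)
  then have "snd (A (int p, q + 1)) \<ge> 0"
    unfolding A_def using n
    by (simp add: bs_transfer_def pos_imp_zdiv_nonneg_iff)
  moreover have "A' (0, 0) = (int m - r, 0)" using r
    by (simp add: A'_def bs_transfer_def zmod_zminus1_eq_if)
  then have "(B ^^ p) (A' (0, 0)) = (int m * (q + 1), 0)"
    using k by (simp add: B_def bs_shift_funpow algebra_simps)
  then have "snd (A ((B ^^ p) (A' (0, 0)))) < 0"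
    using r n by (simp add: A_def bs_transfer_def neg_imp_zdiv_neg_iff pos_imp_zdiv_neg_iff)
  then have "snd ((B ^^ p) (A ((B ^^ p) (A' (0, 0))))) < 0"
    by (cases "A ((B ^^ p) (A' (0, 0)))") (simp add: B_def bs_shift_funpow)
  ultimately show False using eq2 1 by simp
qed

section \<open>Bounded distortion\<close>

text \<open>On every subinterval, the difference quotients of \<open>u\<close> agree up to a factor exponential in its length.
  For a differentiable \<open>u\<close> this says that \<open>ln u'\<close> is Lipschitz; the derivative-free form passes to
  compositions and inverses without the chain rule.\<close>

definition bounded_distortion :: "real \<Rightarrow> real \<Rightarrow> (real \<Rightarrow> real) \<Rightarrow> bool" where
  "bounded_distortion a b u \<longleftrightarrow> (\<exists>M\<ge>0. \<forall>\<alpha> \<beta> p q p' q'.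
     a \<le> \<alpha> \<and> \<beta> \<le> b \<and> \<alpha> \<le> p \<and> p < q \<and> q \<le> \<beta> \<and> \<alpha> \<le> p' \<and> p' < q' \<and> q' \<le> \<beta> \<longrightarrow>
     (u q - u p) * (q' - p') \<le> exp (M * (\<beta> - \<alpha>)) * ((u q' - u p') * (q - p)))"

lemma bounded_distortionE:
  assumes "bounded_distortion a b u"
  obtains M where "M \<ge> 0"
    and "\<And>\<alpha> \<beta> p q p' q'. \<lbrakk>a \<le> \<alpha>; \<beta> \<le> b; \<alpha> \<le> p; p < q; q \<le> \<beta>; \<alpha> \<le> p'; p' < q'; q' \<le> \<beta>\<rbrakk> \<Longrightarrow>
      (u q - u p) * (q' - p') \<le> exp (M * (\<beta> - \<alpha>)) * ((u q' - u p') * (q - p))"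
  using assms unfolding bounded_distortion_def by blast

lemma bounded_distortion_subset:
  assumes "bounded_distortion a b u" "a \<le> a'" "b' \<le> b"
  shows "bounded_distortion a' b' u"
proof -
  obtain M where "M \<ge> 0"
    and "\<And>\<alpha> \<beta> p q p' q'. \<lbrakk>a \<le> \<alpha>; \<beta> \<le> b; \<alpha> \<le> p; p < q; q \<le> \<beta>; \<alpha> \<le> p'; p' < q'; q' \<le> \<beta>\<rbrakk> \<Longrightarrow>
      (u q - u p) * (q' - p') \<le> exp (M * (\<beta> - \<alpha>)) * ((u q' - u p') * (q - p))"
    using bounded_distortionE[OF assms(1)] by metis
  then show ?thesis unfolding bounded_distortion_def using assms by (intro exI[of _ M]) auto
qed

lemma bounded_distortion_cong:
  assumes "bounded_distortion a b u" "\<And>t. \<lbrakk>a \<le> t; t \<le> b\<rbrakk> \<Longrightarrow> v t = u t"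
  shows "bounded_distortion a b v"
proof -
  obtain M where "M \<ge> 0"
    and "\<And>\<alpha> \<beta> p q p' q'. \<lbrakk>a \<le> \<alpha>; \<beta> \<le> b; \<alpha> \<le> p; p < q; q \<le> \<beta>; \<alpha> \<le> p'; p' < q'; q' \<le> \<beta>\<rbrakk> \<Longrightarrow>
      (u q - u p) * (q' - p') \<le> exp (M * (\<beta> - \<alpha>)) * ((u q' - u p') * (q - p))"
    using bounded_distortionE[OF assms(1)] by metis
  then show ?thesis unfolding bounded_distortion_def using assms(2) by (intro exI[of _ M]) auto
qed

lemma bounded_distortion_id: "bounded_distortion a b (\<lambda>t. t)"
  unfolding bounded_distortion_def by (intro exI[of _ 0]) auto

text \<open>The second pair of points is taken to be the ends of \<open>{a..b}\<close>, so
  \<open>C\<close> is the slope of the full chord times the distortion factor. The lower estimate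
  that follows exchanges the two pairs.\<close>

lemma bounded_distortion_lipschitz:
  assumes "bounded_distortion a b u" "strict_mono u"
  obtains C where "C \<ge> 0" "\<And>p q. \<lbrakk>a \<le> p; p \<le> q; q \<le> b\<rbrakk> \<Longrightarrow> u q - u p \<le> C * (q - p)"
proof -
  obtain M where M: "\<And>\<alpha> \<beta> p q p' q'. \<lbrakk>a \<le> \<alpha>; \<beta> \<le> b; \<alpha> \<le> p; p < q; q \<le> \<beta>; \<alpha> \<le> p'; p' < q'; q' \<le> \<beta>\<rbrakk> \<Longrightarrow>
      (u q - u p) * (q' - p') \<le> exp (M * (\<beta> - \<alpha>)) * ((u q' - u p') * (q - p))"
    using bounded_distortionE[OF assms(1)] by metis
  show thesis
  proof (cases "a < b")
    case True
    define C where "C = exp (M * (b - a)) * (u b - u a) / (b - a)"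
    have "u q - u p \<le> C * (q - p)" if "a \<le> p" "p \<le> q" "q \<le> b" for p q
    proof (cases "p = q")
      case False
      then show ?thesis using M[of a b p q a b] that True by (simp add: C_def field_simps)
    qed simp
    moreover have "C \<ge> 0" using True strict_monoD[OF assms(2) True] by (simp add: C_def)
    ultimately show thesis using that by blast
  next
    case False
    then have "p = q" if "a \<le> p" "p \<le> q" "q \<le> b" for p q using that by linarith
    then show thesis using that[of 0] by fastforce
  qed
qed

lemma bounded_distortion_colipschitz:
  assumes "bounded_distortion a b u" "strict_mono u"
  obtains C where "C \<ge> 0" "\<And>p q. \<lbrakk>a \<le> p; p \<le> q; q \<le> b\<rbrakk> \<Longrightarrow> q - p \<le> C * (u q - u p)"
proof -
  obtain M where M: "\<And>\<alpha> \<beta> p q p' q'. \<lbrakk>a \<le> \<alpha>; \<beta> \<le> b; \<alpha> \<le> p; p < q; q \<le> \<beta>; \<alpha> \<le> p'; p' < q'; q' \<le> \<beta>\<rbrakk> \<Longrightarrow>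
      (u q - u p) * (q' - p') \<le> exp (M * (\<beta> - \<alpha>)) * ((u q' - u p') * (q - p))"
    using bounded_distortionE[OF assms(1)] by metis
  show thesis
  proof (cases "a < b")
    case True
    then have ab: "u a < u b" using assms(2) by (simp add: strict_mono_less)
    define C where "C = exp (M * (b - a)) * (b - a) / (u b - u a)"
    have "q - p \<le> C * (u q - u p)" if "a \<le> p" "p \<le> q" "q \<le> b" for p q
    proof (cases "p = q")
      case False
      then show ?thesis using M[of a b a b p q] that ab by (simp add: C_def field_simps)
    qed simp
    moreover have "C \<ge> 0" using True ab by (simp add: C_def)
    ultimately show thesis using that by blast
  next
    case False
    then have "p = q" if "a \<le> p" "p \<le> q" "q \<le> b" for p q using that by linarith
    then show thesis using that[of 0] by fastforce
  qed
qed

text \<open>A difference quotient of the composite is the product of one of \<open>u\<close> and one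
  of \<open>v\<close>. The Lipschitz constant \<open>C\<close> of \<open>v\<close> bounds the
  lengths of image intervals, so the exponents add to \<open>M * C + N\<close>.\<close>

lemma bounded_distortion_comp:
  assumes u: "bounded_distortion (v a) (v b) u" "strict_mono u"
    and v: "bounded_distortion a b v" "strict_mono v"
  shows "bounded_distortion a b (u \<circ> v)"
proof -
  obtain M where M: "M \<ge> 0" "\<And>\<alpha> \<beta> p q p' q'. \<lbrakk>v a \<le> \<alpha>; \<beta> \<le> v b; \<alpha> \<le> p; p < q; q \<le> \<beta>; \<alpha> \<le> p'; p' < q'; q' \<le> \<beta>\<rbrakk> \<Longrightarrow>
      (u q - u p) * (q' - p') \<le> exp (M * (\<beta> - \<alpha>)) * ((u q' - u p') * (q - p))"
    using bounded_distortionE[OF u(1)] by metis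
  obtain N where N: "N \<ge> 0" "\<And>\<alpha> \<beta> p q p' q'. \<lbrakk>a \<le> \<alpha>; \<beta> \<le> b; \<alpha> \<le> p; p < q; q \<le> \<beta>; \<alpha> \<le> p'; p' < q'; q' \<le> \<beta>\<rbrakk> \<Longrightarrow>
      (v q - v p) * (q' - p') \<le> exp (N * (\<beta> - \<alpha>)) * ((v q' - v p') * (q - p))"
    using bounded_distortionE[OF v(1)] by metis
  obtain C where C: "C \<ge> 0" "\<And>p q. \<lbrakk>a \<le> p; p \<le> q; q \<le> b\<rbrakk> \<Longrightarrow> v q - v p \<le> C * (q - p)"
    using bounded_distortion_lipschitz[OF v] by metis
  have "(u (v q) - u (v p)) * (q' - p') \<le> exp ((M * C + N) * (\<beta> - \<alpha>)) * ((u (v q') - u (v p')) * (q - p))"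
    if h: "a \<le> \<alpha>" "\<beta> \<le> b" "\<alpha> \<le> p" "p < q" "q \<le> \<beta>" "\<alpha> \<le> p'" "p' < q'" "q' \<le> \<beta>" for \<alpha> \<beta> p q p' q'
  proof -
    have lt: "v p < v q" "v p' < v q'" "u (v p) < u (v q)" "u (v p') < u (v q')"
      using h u(2) v(2) by (auto simp: strict_mono_less)
    have E: "exp (M * (v \<beta> - v \<alpha>)) \<le> exp (M * C * (\<beta> - \<alpha>))"
      using C(2)[of \<alpha> \<beta>] h M(1) by (simp add: mult_left_mono mult.assoc)
    have "(u (v q) - u (v p)) * (v q' - v p') \<le> exp (M * (v \<beta> - v \<alpha>)) * ((u (v q') - u (v p')) * (v q - v p))"
      using h v(2) lt by (intro M(2)) (auto simp: strict_mono_less_eq strict_mono_less)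
    also have "\<dots> \<le> exp (M * C * (\<beta> - \<alpha>)) * ((u (v q') - u (v p')) * (v q - v p))"
      using E lt by (intro mult_right_mono) auto
    finally have 1: "(u (v q) - u (v p)) * (v q' - v p') \<le> \<dots>" .
    have "((u (v q) - u (v p)) * (q' - p')) * (v q' - v p')
      \<le> exp (M * C * (\<beta> - \<alpha>)) * (u (v q') - u (v p')) * ((v q - v p) * (q' - p'))"
      using mult_right_mono[OF 1, of "q' - p'"] h by (simp add: mult_ac)
    also have "\<dots> \<le> exp (M * C * (\<beta> - \<alpha>)) * (u (v q') - u (v p')) *
        (exp (N * (\<beta> - \<alpha>)) * ((v q' - v p') * (q - p)))"
      using N(2)[OF h] lt by (intro mult_left_mono) auto
    also have "\<dots> = exp ((M * C + N) * (\<beta> - \<alpha>)) * ((u (v q') - u (v p')) * (q - p)) * (v q' - v p')"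
      by (simp add: ring_distribs exp_add mult_ac)
    finally show ?thesis using lt by simp
  qed
  then show ?thesis unfolding bounded_distortion_def using M N C
    by (intro exI[of _ "M * C + N"]) auto
qed

lemma bounded_distortion_inv:
  assumes u: "bounded_distortion a b u" "strict_mono u" "bij u"
  shows "bounded_distortion (u a) (u b) (inv u)"
proof -
  let ?w = "inv u"
  have w: "u (?w t) = t" "?w (u t) = t" for t using u(3) by (simp_all add: bij_is_inj bij_is_surj surj_f_inv_f)
  have wm: "strict_mono ?w" using u by (simp add: strict_mono_inv)
  obtain M where M: "M \<ge> 0" "\<And>\<alpha> \<beta> p q p' q'. \<lbrakk>a \<le> \<alpha>; \<beta> \<le> b; \<alpha> \<le> p; p < q; q \<le> \<beta>; \<alpha> \<le> p'; p' < q'; q' \<le> \<beta>\<rbrakk> \<Longrightarrow>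
      (u q - u p) * (q' - p') \<le> exp (M * (\<beta> - \<alpha>)) * ((u q' - u p') * (q - p))"
    using bounded_distortionE[OF u(1)] by metis
  obtain C where C: "C \<ge> 0" "\<And>p q. \<lbrakk>a \<le> p; p \<le> q; q \<le> b\<rbrakk> \<Longrightarrow> q - p \<le> C * (u q - u p)"
    using bounded_distortion_colipschitz[OF u(1,2)] by metis
  have "(?w q - ?w p) * (q' - p') \<le> exp ((M * C) * (\<beta> - \<alpha>)) * ((?w q' - ?w p') * (q - p))"
    if h: "u a \<le> \<alpha>" "\<beta> \<le> u b" "\<alpha> \<le> p" "p < q" "q \<le> \<beta>" "\<alpha> \<le> p'" "p' < q'" "q' \<le> \<beta>" for \<alpha> \<beta> p q p' q'
  proof -
    have ab: "a \<le> ?w \<alpha>" "?w \<beta> \<le> b" using h u(2) w by (metis strict_mono_less_eq)+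
    have lt: "?w \<alpha> \<le> ?w p" "?w p < ?w q" "?w q \<le> ?w \<beta>" "?w \<alpha> \<le> ?w p'" "?w p' < ?w q'" "?w q' \<le> ?w \<beta>"
      using h wm by (auto simp: strict_mono_less strict_mono_less_eq)
    have E: "exp (M * (?w \<beta> - ?w \<alpha>)) \<le> exp (M * C * (\<beta> - \<alpha>))"
      using C(2)[of "?w \<alpha>" "?w \<beta>"] ab lt M(1) w by (simp add: mult_left_mono mult.assoc)
    \<comment> \<open>Difference quotients of the inverse are reciprocals, so the estimate for
      \<open>u\<close> is applied with the two pairs exchanged.\<close>
    have "(q' - p') * (?w q - ?w p) \<le> exp (M * (?w \<beta> - ?w \<alpha>)) * ((q - p) * (?w q' - ?w p'))"
      using M(2)[OF ab lt(4-6,1-3)] w by simp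
    also have "\<dots> \<le> exp (M * C * (\<beta> - \<alpha>)) * ((q - p) * (?w q' - ?w p'))"
      using E lt h by (intro mult_right_mono) auto
    finally show ?thesis by (simp add: mult_ac)
  qed
  then show ?thesis unfolding bounded_distortion_def using M C
    by (intro exI[of _ "M * C"]) auto
qed

lemma bounded_distortion_continuous:
  assumes "bounded_distortion a b u" "strict_mono u"
  shows "continuous_on {a..b} u"
proof -
  obtain C where C: "C \<ge> 0" "\<And>p q. \<lbrakk>a \<le> p; p \<le> q; q \<le> b\<rbrakk> \<Longrightarrow> u q - u p \<le> C * (q - p)"
    using bounded_distortion_lipschitz[OF assms] by metis
  have "C-lipschitz_on {a..b} u"
  proof (rule lipschitz_onI)
    fix p q assume "p \<in> {a..b}" "q \<in> {a..b}"
    then show "dist (u p) (u q) \<le> C * dist p q"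
      using C(2)[of p q] C(2)[of q p] strict_mono_less_eq[OF assms(2), of p q]
        strict_mono_less_eq[OF assms(2), of q p]
      by (cases "p \<le> q") (auto simp: dist_real_def abs_if)
  qed (use C in simp)
  then show ?thesis by (rule lipschitz_on_continuous_on)
qed

section \<open>From C^2 regularity to bounded distortion\<close>

text \<open>The chain rule gives \<open>k * l = 1\<close>, so \<open>l\<close> is nonzero; a
  negative sign would contradict monotonicity on a side of \<open>t\<close> that stays in the
  interval.\<close>

lemma derivative_pos_of_inverse:
  assumes d: "(u has_real_derivative l) (at t within {a..b})" and t: "t \<in> {a..b}" "a < b"
    and mono: "strict_mono_on {a..b} u"
    and inv: "\<And>s. s \<in> {a..b} \<Longrightarrow> w (u s) = s"
    and w: "(w has_real_derivative k) (at (u t) within u ` {a..b})"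
  shows "l > 0"
proof -
  have "((w \<circ> u) has_real_derivative (k * l)) (at t within {a..b})"
    using d w by (rule DERIV_image_chain[rotated])
  then have "((\<lambda>s. s) has_real_derivative (k * l)) (at t within {a..b})"
    by (rule has_field_derivative_transform_within[OF _ zero_less_one t(1)]) (simp add: inv)
  moreover have "((\<lambda>s. s) has_real_derivative 1) (at t within {a..b})"
    by (rule DERIV_ident)
  ultimately have "k * l = 1"
    using vector_derivative_unique_within_closed_interval[of a b t "\<lambda>s. s"] t
    by (simp add: has_real_derivative_iff_has_vector_derivative)
  then have "l \<noteq> 0" by auto
  moreover have "\<not> l < 0"
  proof
    assume l: "l < 0"
    show False
    proof (cases "t < b")
      case True
      obtain e where e: "e > 0" "\<And>h. h > 0 \<Longrightarrow> t + h \<in> {a..b} \<Longrightarrow> h < e \<Longrightarrow> u (t + h) < u t"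
        using has_real_derivative_neg_dec_right[OF d l] by blast
      define h where "h = min (e / 2) (b - t)"
      have "h > 0" "t + h \<in> {a..b}" "h < e" using e True t by (auto simp: h_def min_def)
      then show False using e(2)[of h] strict_mono_onD[OF mono t(1), of "t + h"] by auto
    next
      case False
      then have tb: "t = b" using t by simp
      obtain e where e: "e > 0" "\<And>h. h > 0 \<Longrightarrow> t - h \<in> {a..b} \<Longrightarrow> h < e \<Longrightarrow> u t < u (t - h)"
        using has_real_derivative_neg_dec_left[OF d l] by blast
      define h where "h = min (e / 2) (b - a)"
      have "h > 0" "t - h \<in> {a..b}" "h < e" using e tb t by (auto simp: h_def min_def)
      then show False using e(2)[of h] strict_mono_onD[OF mono, of "t - h" t] t by auto
    qed
  qed
  ultimately show ?thesis by linarith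
qed

text \<open>The derivative \<open>u2 / u1\<close> of \<open>ln u1\<close> is bounded by compactness,
  so \<open>ln u1\<close> is Lipschitz; the mean value theorem turns difference quotients of
  \<open>u\<close> into values of \<open>u1\<close>. The differentiable inverse \<open>w\<close>
  makes \<open>u1\<close> positive.\<close>

lemma C2_on_bounded_distortion:
  assumes C2: "C2_on {a..b} u" and ab: "a < b" and mono: "strict_mono_on {a..b} u"
    and inv: "\<And>s. s \<in> {a..b} \<Longrightarrow> w (u s) = s"
    and w: "\<And>t. t \<in> {a..b} \<Longrightarrow> \<exists>k. (w has_real_derivative k) (at (u t) within u ` {a..b})"
  shows "bounded_distortion a b u"
proof -
  obtain u1 u2 where u1: "\<And>t. t \<in> {a..b} \<Longrightarrow> (u has_real_derivative u1 t) (at t within {a..b})"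
    and u2: "\<And>t. t \<in> {a..b} \<Longrightarrow> (u1 has_real_derivative u2 t) (at t within {a..b})"
    and c2: "continuous_on {a..b} u2"
    using C2 unfolding C2_on_def by blast
  have pos: "u1 t > 0" if "t \<in> {a..b}" for t
    using derivative_pos_of_inverse[OF u1[OF that] that ab mono inv] w[OF that] by blast
  have c1: "continuous_on {a..b} u1" using u2 by (meson DERIV_continuous_on)
  have nz: "\<forall>t\<in>{a..b}. u1 t \<noteq> 0" using pos by (metis less_irrefl)
  have "compact ((\<lambda>t. u2 t / u1 t) ` {a..b})"
    using c1 c2 nz by (intro compact_continuous_image continuous_on_divide) auto
  then obtain M where "\<forall>y \<in> (\<lambda>t. u2 t / u1 t) ` {a..b}. norm y \<le> M"
    using compact_imp_bounded bounded_iff by metis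
  then have M: "\<bar>u2 t / u1 t\<bar> \<le> M" if "t \<in> {a..b}" for t using that by auto
  have M0: "M \<ge> 0" using order_trans[OF abs_ge_zero M[of a]] ab by simp
  have ln: "ln (u1 s) - ln (u1 t) \<le> M * \<bar>s - t\<bar>" if "s \<in> {a..b}" "t \<in> {a..b}" for s t
  proof -
    have D: "((\<lambda>x. ln (u1 x)) has_real_derivative u2 x / u1 x) (at x within {a..b})" if "x \<in> {a..b}" for x
      by (rule DERIV_cong[OF DERIV_chain2[OF DERIV_ln[OF pos[OF that]] u2[OF that]]]) (simp add: field_simps)
    have "norm (u2 z / u1 z) \<le> M" if "z \<in> {a..b}" for z
      using M[OF that] unfolding real_norm_def .
    note bound = field_differentiable_bound[OF convex_real_interval(5) D this that]
    have "norm (ln (u1 s) - ln (u1 t)) \<le> M * norm (s - t)"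
      by (rule bound)
    then show ?thesis by simp
  qed
  have mvt: "\<exists>\<xi>\<in>{p..q}. u q - u p = (q - p) * u1 \<xi>" if "a \<le> p" "p < q" "q \<le> b" for p q
  proof -
    have "(u has_derivative (*) (u1 x)) (at x within {p..q})" if "p \<le> x" "x \<le> q" for x
    proof -
      have "(u has_real_derivative u1 x) (at x within {p..q})"
        using \<open>a \<le> p\<close> \<open>q \<le> b\<close> that by (intro DERIV_subset[OF u1]) auto
      then show ?thesis by (simp only: has_field_derivative_def)
    qed
    from mvt_simple[OF \<open>p < q\<close> this]
    have "\<exists>x\<in>{p<..<q}. u q - u p = u1 x * (q - p)" by blast
    then show ?thesis by (auto simp: mult.commute intro!: bexI)
  qed
  have "(u q - u p) * (q' - p') \<le> exp (M * (\<beta> - \<alpha>)) * ((u q' - u p') * (q - p))"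
    if h: "a \<le> \<alpha>" "\<beta> \<le> b" "\<alpha> \<le> p" "p < q" "q \<le> \<beta>" "\<alpha> \<le> p'" "p' < q'" "q' \<le> \<beta>" for \<alpha> \<beta> p q p' q'
  proof -
    have ends: "a \<le> p" "q \<le> b" "a \<le> p'" "q' \<le> b" using h by linarith+
    obtain \<xi> where x: "\<xi> \<in> {p..q}" "u q - u p = (q - p) * u1 \<xi>"
      using mvt[OF ends(1) h(4) ends(2)] by blast
    obtain \<eta> where y: "\<eta> \<in> {p'..q'}" "u q' - u p' = (q' - p') * u1 \<eta>"
      using mvt[OF ends(3) h(7) ends(4)] by blast
    have in_ab: "\<xi> \<in> {a..b}" "\<eta> \<in> {a..b}" using x(1) y(1) h by auto
    have "M * \<bar>\<xi> - \<eta>\<bar> \<le> M * (\<beta> - \<alpha>)" using x(1) y(1) h M0 by (intro mult_left_mono) auto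
    then have "ln (u1 \<xi>) \<le> M * (\<beta> - \<alpha>) + ln (u1 \<eta>)" using ln[OF in_ab] by simp
    then have "exp (ln (u1 \<xi>)) \<le> exp (M * (\<beta> - \<alpha>)) * exp (ln (u1 \<eta>))"
      by (simp only: exp_add[symmetric] exp_le_cancel_iff)
    then have "u1 \<xi> \<le> exp (M * (\<beta> - \<alpha>)) * u1 \<eta>" using pos[OF in_ab(1)] pos[OF in_ab(2)] by simp
    then have "(q - p) * (q' - p') * u1 \<xi> \<le> (q - p) * (q' - p') * (exp (M * (\<beta> - \<alpha>)) * u1 \<eta>)"
      using h by (intro mult_left_mono) auto
    then show ?thesis unfolding x(2) y(2) by (simp add: mult_ac)
  qed
  then show ?thesis unfolding bounded_distortion_def using M0 by (intro exI[of _ M]) auto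
qed

section \<open>Kopell's lemma\<close>

lemma strict_mono_funpow: "strict_mono u \<Longrightarrow> strict_mono (u ^^ k)" for u :: "'a::order \<Rightarrow> 'a"
  by (induction k) (auto simp: strict_mono_def)

lemma funpow_fixed: "u x = x \<Longrightarrow> (u ^^ k) x = x"
  by (induction k) auto

lemma bounded_distortion_funpow:
  assumes "bounded_distortion a b u" "strict_mono u" "u a = a" "u b = b"
  shows "bounded_distortion a b (u ^^ k)"
proof (induction k)
  case 0
  then show ?case using bounded_distortion_id by (simp add: id_def)
next
  case (Suc k)
  have "bounded_distortion a b (u \<circ> u ^^ k)"
    using assms Suc by (intro bounded_distortion_comp strict_mono_funpow) (auto simp: funpow_fixed)
  then show ?case by (simp only: funpow.simps)
qed

text \<open>Otherwise the orbit has an infimum \<open>L\<close> in the interval, with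
  \<open>h L < L < inv h L\<close>. Some orbit point lies below \<open>inv h L\<close>, and the next
  one lies below \<open>L\<close>. Monotonicity and bijectivity stand in for continuity.\<close>

lemma contraction_orbit_le:
  fixes h :: "real \<Rightarrow> real"
  assumes h: "bij h" "strict_mono h" and lt: "\<And>t. \<lbrakk>x < t; t < y\<rbrakk> \<Longrightarrow> h t < t"
    and s: "x < s" and t: "t < y"
  shows "\<exists>k. (h ^^ k) t \<le> s"
proof (rule ccontr)
  assume "\<not> ?thesis"
  then have gt: "s < (h ^^ k) t" for k by (simp add: not_le)
  define L where "L = Inf (range (\<lambda>k. (h ^^ k) t))"
  have bdd: "bdd_below (range (\<lambda>k. (h ^^ k) t))" using gt by (auto intro!: bdd_belowI[of _ s] less_imp_le)
  have le: "L \<le> (h ^^ k) t" for k unfolding L_def using bdd by (intro cInf_lower) auto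
  have "s \<le> L" unfolding L_def using gt by (intro cInf_greatest) (auto intro: less_imp_le)
  then have "h L < L" using le[of 0] s t by (intro lt) auto
  moreover have hi: "h (inv h L) = L" using h by (simp add: bij_is_surj surj_f_inv_f)
  ultimately have "L < inv h L" using h(2) by (metis strict_mono_less)
  then obtain k where "(h ^^ k) t < inv h L"
    unfolding L_def using bdd by (subst (asm) cInf_less_iff) auto
  then have "(h ^^ Suc k) t < L" using h(2) hi by (metis comp_apply funpow.simps(2) strict_mono_less)
  then show False using le[of "Suc k"] by simp
qed

text \<open>The images of \<open>{h p..p}\<close> under successive powers are adjacent, so the
  exponents of the single steps telescope to \<open>M * (p - (h ^^ k) p)\<close>, at most
  \<open>M * (p - x)\<close> for every \<open>k\<close>.\<close>

lemma funpow_distortion: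
  assumes h: "strict_mono h" "h x = x" "h p \<le> p" "x < p" and bd: "bounded_distortion x p h"
  shows "\<exists>K\<ge>0. \<forall>k s t s' t'. h p \<le> s \<and> s < t \<and> t \<le> p \<and> h p \<le> s' \<and> s' < t' \<and> t' \<le> p \<longrightarrow>
     ((h ^^ k) t - (h ^^ k) s) * (t' - s') \<le> K * (((h ^^ k) t' - (h ^^ k) s') * (t - s))"
proof -
  obtain M where M: "M \<ge> 0"
    "\<And>\<alpha> \<beta> a b a' b'. \<lbrakk>x \<le> \<alpha>; \<beta> \<le> p; \<alpha> \<le> a; a < b; b \<le> \<beta>; \<alpha> \<le> a'; a' < b'; b' \<le> \<beta>\<rbrakk> \<Longrightarrow>
      (h b - h a) * (b' - a') \<le> exp (M * (\<beta> - \<alpha>)) * ((h b' - h a') * (b - a))"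
    using bounded_distortionE[OF bd] by metis
  have ge: "x \<le> (h ^^ k) p" for k
    using strict_mono_less_eq[OF strict_mono_funpow[OF h(1)], of k x p] h(2,4) by (simp add: funpow_fixed)
  have le: "(h ^^ k) p \<le> p" for k
  proof (induction k)
    case (Suc k)
    then show ?case using h(1,3) by (metis comp_apply funpow.simps(2) order_trans strict_mono_less_eq)
  qed simp
  have step: "((h ^^ k) t - (h ^^ k) s) * (t' - s') \<le>
     exp (M * (p - (h ^^ k) p)) * (((h ^^ k) t' - (h ^^ k) s') * (t - s))"
    if I: "h p \<le> s" "s < t" "t \<le> p" "h p \<le> s'" "s' < t'" "t' \<le> p" for k s t s' t'
  proof (induction k)
    case (Suc k)
    define H where "H = h ^^ k"
    have H: "strict_mono H" unfolding H_def using h(1) by (rule strict_mono_funpow)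
    have HS: "h ^^ Suc k = (\<lambda>t. h (H t))" by (auto simp: H_def)
    have hH: "h (H p) = H (h p)" unfolding H_def by (metis comp_apply funpow.simps(2) funpow_Suc_right)
    have lt: "H s < H t" "H s' < H t'" "h (H s) < h (H t)" "h (H s') < h (H t')"
      using H h(1) I by (auto simp: strict_mono_less)
    have 1: "(h (H t) - h (H s)) * (H t' - H s') \<le> exp (M * (H p - h (H p))) * ((h (H t') - h (H s')) * (H t - H s))"
      using H lt I ge[of "Suc k"] le[of k] hH
      by (intro M(2)) (auto simp: strict_mono_less_eq HS H_def[symmetric])
    have "(h (H t) - h (H s)) * (t' - s') * (H t' - H s') \<le>
        exp (M * (H p - h (H p))) * (h (H t') - h (H s')) * ((H t - H s) * (t' - s'))"
      using mult_right_mono[OF 1, of "t' - s'"] I by (simp add: mult_ac)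
    also have "\<dots> \<le> exp (M * (H p - h (H p))) * (h (H t') - h (H s')) * (exp (M * (p - H p)) * ((H t' - H s') * (t - s)))"
      using Suc.IH lt unfolding H_def[symmetric] by (intro mult_left_mono) auto
    also have "\<dots> = (exp (M * (H p - h (H p))) * exp (M * (p - H p))) * ((h (H t') - h (H s')) * (t - s)) * (H t' - H s')"
      by (simp add: mult_ac)
    also have "exp (M * (H p - h (H p))) * exp (M * (p - H p)) = exp (M * (p - h (H p)))"
      by (simp add: algebra_simps flip: exp_add)
    finally show ?case using lt unfolding HS by simp
  qed simp
  show ?thesis
  proof (intro exI[of _ "exp (M * (p - x))"] conjI allI impI, goal_cases)
    case (2 k s t s' t')
    have "exp (M * (p - (h ^^ k) p)) \<le> exp (M * (p - x))" using M(1) ge[of k] by (simp add: mult_left_mono)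
    then have "exp (M * (p - (h ^^ k) p)) * (((h ^^ k) t' - (h ^^ k) s') * (t - s)) \<le>
        exp (M * (p - x)) * (((h ^^ k) t' - (h ^^ k) s') * (t - s))"
      using 2 strict_mono_less[OF strict_mono_funpow[OF h(1)], of k s' t']
      by (intro mult_right_mono) auto
    then show ?case using step[of s t s' t' k] 2 by linarith
  qed simp
qed

lemma commuting_funpow: "(\<And>t. d (h t) = h (d t)) \<Longrightarrow> d ((h ^^ k) t) = (h ^^ k) (d t)"
  by (induction k) auto

text \<open>Since \<open>d = h ^^ (- k) \<circ> d \<circ> h ^^ k\<close>, and \<open>d\<close> is nearly an isometry on \<open>{x..(h ^^ k) p}\<close>, whose ends it fixes,
  the Lipschitz constant of \<open>d\<close> is bounded by the distortion of \<open>h ^^ k\<close> alone, uniformly in \<open>d\<close>.\<close>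

lemma centralizer_lipschitz:
  assumes h: "bij h" "strict_mono h" "h x = x" and lt: "\<And>t. \<lbrakk>x < t; t < y\<rbrakk> \<Longrightarrow> h t < t"
    and p: "x < p" "p < y" and bd: "bounded_distortion x p h"
  shows "\<exists>K\<ge>0. \<forall>d. strict_mono d \<and> (\<forall>t. d (h t) = h (d t)) \<and> d x = x \<and> d p = p \<and> bounded_distortion x p d
     \<longrightarrow> (\<forall>s t. h p \<le> s \<and> s < t \<and> t \<le> p \<longrightarrow> d t - d s \<le> K * (t - s))"
proof -
  obtain K where K: "K \<ge> 0" "\<And>k s t s' t'. \<lbrakk>h p \<le> s; s < t; t \<le> p; h p \<le> s'; s' < t'; t' \<le> p\<rbrakk> \<Longrightarrow>
     ((h ^^ k) t - (h ^^ k) s) * (t' - s') \<le> K * (((h ^^ k) t' - (h ^^ k) s') * (t - s))"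
    using funpow_distortion[OF h(2,3) less_imp_le[OF lt[OF p]] p(1) bd] by blast
  have "d t - d s \<le> 2 * K * (t - s)"
    if d: "strict_mono d" "\<And>t. d (h t) = h (d t)" "d x = x" "d p = p" "bounded_distortion x p d"
      and st: "h p \<le> s" "s < t" "t \<le> p" for d s t
  proof -
    obtain N where N: "N \<ge> 0" "\<And>\<alpha> \<beta> a b a' b'. \<lbrakk>x \<le> \<alpha>; \<beta> \<le> p; \<alpha> \<le> a; a < b; b \<le> \<beta>; \<alpha> \<le> a'; a' < b'; b' \<le> \<beta>\<rbrakk> \<Longrightarrow>
      (d b - d a) * (b' - a') \<le> exp (N * (\<beta> - \<alpha>)) * ((d b' - d a') * (b - a))"
      using bounded_distortionE[OF d(5)] by metis
    \<comment> \<open>Close enough to \<open>x\<close> that the distortion of \<open>d\<close>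
      between \<open>x\<close> and \<open>s0\<close> is at most 2; the \<open>+ 1\<close> covers
      \<open>N = 0\<close>.\<close>
    define s0 where "s0 = min p (x + ln 2 / (N + 1))"
    have "x < s0" using p N(1) by (simp add: s0_def)
    then obtain k where k: "(h ^^ k) p \<le> s0" using contraction_orbit_le[OF h(1,2) lt _ p(2)] by blast
    define H where "H = h ^^ k"
    have H: "strict_mono H" unfolding H_def using h(2) by (rule strict_mono_funpow)
    have dH: "d (H t) = H (d t)" for t unfolding H_def using d(2) by (rule commuting_funpow)
    have Hx: "H x = x" unfolding H_def using h(3) by (rule funpow_fixed)
    have xH: "x < H p" using H p Hx by (metis strict_mono_less)
    have "N * (H p - x) \<le> N * (ln 2 / (N + 1))"
      using k N(1) by (intro mult_left_mono) (auto simp: s0_def H_def)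
    also have "\<dots> \<le> ln 2" using N(1) by (simp add: field_simps)
    finally have E: "exp (N * (H p - x)) \<le> 2" by (metis exp_le_cancel_iff exp_ln zero_less_numeral)
    have xp: "x \<le> h p" using h(2,3) p by (metis less_imp_le strict_mono_less)
    have Hst: "x \<le> H s" "H s < H t" "H t \<le> H p"
      using H st xp Hx by (auto simp: strict_mono_less strict_mono_less_eq) (metis order_trans strict_mono_less_eq)
    \<comment> \<open>The second chord is that of \<open>{x..H p}\<close>, whose ends are fixed by
      \<open>d\<close>, so its slope is 1.\<close>
    have "(d (H t) - d (H s)) * (H p - x) \<le> exp (N * (H p - x)) * ((d (H p) - d x) * (H t - H s))"
      using Hst xH k by (intro N(2)) (auto simp: s0_def H_def)
    also have "\<dots> = (exp (N * (H p - x)) * (H t - H s)) * (H p - x)" by (simp add: dH d)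
    finally have "d (H t) - d (H s) \<le> exp (N * (H p - x)) * (H t - H s)" using xH by simp
    also have "\<dots> \<le> 2 * (H t - H s)" using E Hst by (intro mult_right_mono) auto
    finally have 1: "H (d t) - H (d s) \<le> 2 * (H t - H s)" by (simp add: dH)
    \<comment> \<open>Since \<open>d\<close> preserves \<open>{h p..p}\<close>, the distortion of
      \<open>H\<close> can compare \<open>{s..t}\<close> with its image under
      \<open>d\<close>.\<close>
    have "h p \<le> d s" "d s < d t" "d t \<le> p"
      using d st by (metis strict_mono_less_eq strict_mono_less)+
    then have "(H t - H s) * (d t - d s) \<le> K * ((H (d t) - H (d s)) * (t - s))"
      using K(2)[of s t "d s" "d t" k] st unfolding H_def by simp
    also have "\<dots> \<le> K * ((2 * (H t - H s)) * (t - s))"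
      using 1 st K(1) by (intro mult_left_mono mult_right_mono) auto
    also have "\<dots> = (H t - H s) * (2 * K * (t - s))" by (simp add: algebra_simps)
    finally show ?thesis using Hst by simp
  qed
  then show ?thesis using K(1) by (intro exI[of _ "2 * K"]) auto
qed

text \<open>The intervals between consecutive points of the backward orbit of \<open>t\<close> are disjoint, and the power \<open>c ^^ Suc i\<close>,
  whose Lipschitz constant does not depend on \<open>i\<close>, stretches the one with index \<open>i\<close> onto \<open>{t..c t}\<close>.\<close>

lemma kopell_le:
  assumes h: "bij h" "strict_mono h" "h x = x" and lt: "\<And>t. \<lbrakk>x < t; t < y\<rbrakk> \<Longrightarrow> h t < t"
    and p: "x < p" "p < y" and bd: "bounded_distortion x p h"
    and c: "bij c" "strict_mono c" "\<And>t. c (h t) = h (c t)" "c x = x" "c p = p" "bounded_distortion x p c"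
    and t: "h p \<le> t" "t \<le> p"
  shows "c t \<le> t"
proof (rule ccontr)
  assume "\<not> c t \<le> t"
  then have ct: "t < c t" by simp
  obtain K where K: "K \<ge> 0" "\<And>d s t. \<lbrakk>strict_mono d; \<And>t. d (h t) = h (d t); d x = x; d p = p; bounded_distortion x p d;
     h p \<le> s; s < t; t \<le> p\<rbrakk> \<Longrightarrow> d t - d s \<le> K * (t - s)"
    using centralizer_lipschitz[OF h lt p bd] by blast
  define s where "s = (\<lambda>i. (inv c ^^ i) t)"
  have ic: "c (inv c r) = r" "inv c (c r) = r" for r
    using c(1) by (simp_all add: bij_is_surj surj_f_inv_f bij_is_inj)
  have im: "strict_mono (inv c)" using c by (simp add: strict_mono_inv)
  have cp: "(c ^^ i) (s i) = t" for i
  proof (induction i)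
    case (Suc i)
    then show ?case unfolding s_def by (simp only: funpow_Suc_right[of i c]) (simp add: ic)
  qed (simp add: s_def)
  have sc: "c (s (Suc i)) = s i" for i by (simp add: s_def ic)
  have "inv c t < t" using ct im ic by (metis strict_mono_less)
  then have dec: "s (Suc i) < s i" for i
    using strict_mono_less[OF strict_mono_funpow[OF im], of i "inv c t" t]
    by (simp add: s_def funpow_swap1)
  have chp: "c (h p) = h p" using c by simp
  then have ichp: "inv c (h p) = h p" using ic by metis
  have lo: "h p \<le> s i" for i
    using strict_mono_less_eq[OF strict_mono_funpow[OF im], of i "h p" t] t ichp
    by (simp add: s_def funpow_fixed)
  have hi: "s i \<le> t" for i
  proof (induction i)
    case (Suc i)
    then show ?case using dec[of i] by simp
  qed (simp add: s_def)
  have e: "c t - t \<le> K * (s i - s (Suc i))" for i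
  proof -
    have "(c ^^ Suc i) (s i) - (c ^^ Suc i) (s (Suc i)) \<le> K * (s i - s (Suc i))"
    proof (rule K(2))
      show "(c ^^ Suc i) (h r) = h ((c ^^ Suc i) r)" for r
        using commuting_funpow[of h c "Suc i" r] c(3) by simp
      show "s i \<le> p" using hi[of i] t by simp
    qed (use c dec lo in \<open>auto intro: strict_mono_funpow bounded_distortion_funpow simp del: funpow.simps simp: funpow_fixed\<close>)
    moreover have "(c ^^ Suc i) (s i) = c t" by (simp add: cp)
    ultimately show ?thesis by (simp only: cp)
  qed
  \<comment> \<open>The \<open>N\<close> gaps are consecutive and sum to \<open>t - s N\<close>, at
    most \<open>t - h p\<close> however large \<open>N\<close> is.\<close>
  have tel: "real N * (c t - t) \<le> K * (t - s N)" for N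
  proof (induction N)
    case (Suc N)
    then show ?case using e[of N] by (simp add: algebra_simps)
  qed (simp add: s_def)
  have "real N * (c t - t) \<le> K * (t - h p)" for N
    using tel[of N] lo[of N] K(1) by (meson diff_left_mono mult_left_mono order_trans)
  moreover obtain N where "K * (t - h p) < real N * (c t - t)"
    using reals_Archimedean3[of "c t - t"] ct by auto
  ultimately show False by (meson not_le)
qed

lemma kopell_fundamental_domain:
  assumes h: "bij h" "strict_mono h" "h x = x" and lt: "\<And>t. \<lbrakk>x < t; t < y\<rbrakk> \<Longrightarrow> h t < t"
    and p: "x < p" "p < y" and bd: "bounded_distortion x p h"
    and c: "bij c" "strict_mono c" "\<And>t. c (h t) = h (c t)" "c x = x" "c p = p" "bounded_distortion x p c"
    and t: "h p \<le> t" "t \<le> p"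
  shows "c t = t"
proof (rule antisym)
  show "c t \<le> t" using kopell_le[OF h lt p bd c t] .
  have ic: "c (inv c r) = r" "inv c (c r) = r" for r
    using c(1) by (simp_all add: bij_is_surj surj_f_inv_f bij_is_inj)
  have "inv c t \<le> t"
  proof (rule kopell_le[OF h lt p bd _ _ _ _ _ _ t])
    show "bij (inv c)" "strict_mono (inv c)" using c by (auto simp: bij_imp_bij_inv strict_mono_inv)
    show "inv c (h t) = h (inv c t)" for t using ic c(3) by metis
    show "inv c x = x" "inv c p = p" using ic c by metis+
    show "bounded_distortion x p (inv c)" using bounded_distortion_inv[OF c(6,2,1)] c by simp
  qed
  then show "t \<le> c t" using c(2) ic by (metis strict_mono_less_eq)
qed

text \<open>Every \<open>(h ^^ k) p\<close> is fixed by \<open>c\<close>, and the intervals between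
  consecutive ones cover the points between \<open>x\<close> and \<open>p\<close>, where the
  fundamental-domain case applies. A point above \<open>p\<close> is first pushed down by a power of
  \<open>h\<close>, which commutes with \<open>c\<close> and is injective.\<close>

theorem kopell:
  assumes h: "bij h" "strict_mono h" "h x = x" and lt: "\<And>t. \<lbrakk>x < t; t < y\<rbrakk> \<Longrightarrow> h t < t"
    and bd: "bounded_distortion x y h"
    and c: "bij c" "strict_mono c" "\<And>t. c (h t) = h (c t)" "c x = x" "bounded_distortion x y c"
    and p: "x < p" "p < y" "c p = p" and t: "x < t" "t < y"
  shows "c t = t"
proof -
  have low: "c s = s" if s: "x < s" "s \<le> p" for s
  proof (cases "s = p")
    case False
    define P where "P k \<longleftrightarrow> (h ^^ k) p < s" for k
    obtain i where i: "(h ^^ i) p \<le> (x + s) / 2"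
      using contraction_orbit_le[OF h(1,2) lt _ p(2), of x "(x + s) / 2"] s by auto
    then have "P i" using s by (simp add: P_def)
    moreover have "\<not> P 0" using s by (simp add: P_def)
    \<comment> \<open>The orbit of \<open>p\<close> passes below \<open>s\<close> at step
      \<open>Suc k\<close>, which places \<open>s\<close> between \<open>h ?q\<close> and
      \<open>?q\<close>.\<close>
    ultimately obtain k where k: "\<not> P k" "P (Suc k)"
      using ex_least_nat_less[of P i] by blast
    let ?q = "(h ^^ k) p"
    have q: "h ?q \<le> s" "s \<le> ?q" using k by (auto simp: P_def)
    have "?q \<le> p"
    proof (induction k)
      case (Suc k)
      have "x < (h ^^ k) p"
        using strict_mono_less[OF strict_mono_funpow[OF h(2)], of k x p] p h(3) by (simp add: funpow_fixed)
      then have "h ((h ^^ k) p) < (h ^^ k) p" using Suc p by (intro lt) auto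
      then show ?case using Suc by simp
    qed simp
    then have "x < ?q" "?q < y" using s q p by auto
    moreover have "c ?q = ?q" using commuting_funpow[of c h k p] c(3) p by simp
    ultimately show ?thesis
      using kopell_fundamental_domain[OF h lt _ _ _ c(1-4) _ _ q] bd c(5)
        bounded_distortion_subset[of x y _ x ?q] by simp
  qed (use p in simp)
  obtain k where k: "(h ^^ k) t \<le> p"
    using contraction_orbit_le[OF h(1,2) lt p(1) t(2)] by blast
  have inc: "strict_mono (h ^^ k)" using h(2) by (rule strict_mono_funpow)
  then have "x < (h ^^ k) t" using t h(3) by (metis funpow_fixed strict_mono_less)
  then have "(h ^^ k) (c t) = (h ^^ k) t" using low[OF _ k] commuting_funpow[of c h k t] c(3) by simp
  then show ?thesis using inc by (simp add: strict_mono_eq)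
qed

section \<open>Increasing maps with a common power\<close>

lemma continuous_no_crossing:
  fixes f g :: "real \<Rightarrow> real"
  assumes "continuous_on {x..y} f" "continuous_on {x..y} g"
    and ne: "\<And>t. \<lbrakk>x < t; t < y\<rbrakk> \<Longrightarrow> f t \<noteq> g t"
  shows "(\<forall>t. x < t \<and> t < y \<longrightarrow> f t < g t) \<or> (\<forall>t. x < t \<and> t < y \<longrightarrow> g t < f t)"
proof (rule ccontr)
  assume "\<not> ?thesis"
  then obtain s t where s: "x < s" "s < y" "g s < f s" and t: "x < t" "t < y" "f t < g t"
    using ne by (meson linorder_neqE_linordered_idom)
  define A where "A = (\<lambda>r. f r - g r) ` {x<..<y}"
  have "connected A"
    unfolding A_def using assms(1,2)
    by (intro connected_continuous_image continuous_intros) (auto intro: continuous_on_subset)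
  moreover have "f s - g s \<in> A" "f t - g t \<in> A" using s t by (auto simp: A_def)
  ultimately have "0 \<in> A" using s t unfolding connected_iff_interval
    by (meson diff_ge_0_iff_ge diff_le_0_iff_le less_imp_le)
  then show False using ne by (auto simp: A_def)
qed

text \<open>The orbit of a point moved up by an increasing map stays above it, and likewise below
  for one moved down, so it never returns.\<close>

lemma strict_mono_funpow_fixed:
  fixes u :: "'a::linorder \<Rightarrow> 'a"
  assumes u: "strict_mono u" and fp: "(u ^^ k) x = x" and k: "k > 0"
  shows "u x = x"
proof -
  have up: "x < (u ^^ Suc i) x" if "x < u x" for i
  proof (induction i)
    case (Suc i)
    then have "u x < u ((u ^^ Suc i) x)" using u by (simp only: strict_mono_less)
    then show ?case using that by simp
  qed (use that in simp)
  have down: "(u ^^ Suc i) x < x" if "u x < x" for i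
  proof (induction i)
    case (Suc i)
    then have "u ((u ^^ Suc i) x) < u x" using u by (simp only: strict_mono_less)
    then show ?case using that by simp
  qed (use that in simp)
  obtain i where i: "k = Suc i" using k by (cases k) auto
  show ?thesis using up[of i] down[of i] fp unfolding i by (metis less_irrefl linorder_neqE)
qed

text \<open>Otherwise \<open>u \<circ> v\<close> and \<open>v \<circ> u\<close> would be strictly ordered along the whole interval, and
  iterating would strictly order \<open>u ^^ n \<circ> v\<close> and \<open>v \<circ> u ^^ n\<close>, which agree.\<close>

lemma common_power_coincidence:
  fixes u v :: "real \<Rightarrow> real"
  assumes u: "strict_mono u" "continuous_on {x..y} u" "u x = x" "u y = y"
    and v: "strict_mono v" "continuous_on {x..y} v" "v x = x" "v y = y"
    and comm: "\<And>t. (u ^^ n) (v t) = v ((u ^^ n) t)" and n: "n > 0" and xy: "x < y"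
  shows "\<exists>t. x < t \<and> t < y \<and> u (v t) = v (u t)"
proof (rule ccontr)
  assume "\<not> ?thesis"
  then have ne: "u (v t) \<noteq> v (u t)" if "x < t" "t < y" for t using that by blast
  have inv: "x < u t \<and> u t < y" if "x < t \<and> t < y" for t
    using that u by (metis strict_mono_less)
  have invn: "x < (u ^^ k) t \<and> (u ^^ k) t < y" if "x < t \<and> t < y" for k t
    using that inv by (induction k) auto
  have sub: "u ` {x..y} \<subseteq> {x..y}" "v ` {x..y} \<subseteq> {x..y}"
    using u v by (auto simp: image_subset_iff) (metis strict_mono_less_eq)+
  have "continuous_on {x..y} (\<lambda>t. u (v t))" "continuous_on {x..y} (\<lambda>t. v (u t))"
    using u(2) v(2) sub by (auto intro: continuous_on_compose2)
  from continuous_no_crossing[OF this] ne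
  consider "\<And>t. x < t \<and> t < y \<Longrightarrow> u (v t) < v (u t)" | "\<And>t. x < t \<and> t < y \<Longrightarrow> v (u t) < u (v t)"
    by blast
  then show False
  proof cases
    case 1
    have "(u ^^ Suc k) (v t) < v ((u ^^ Suc k) t)" if "x < t \<and> t < y" for k t
    proof (induction k)
      case (Suc k)
      then have "u ((u ^^ Suc k) (v t)) < u (v ((u ^^ Suc k) t))" using u(1) by (simp only: strict_mono_less)
      also have "\<dots> < v (u ((u ^^ Suc k) t))" using invn[OF that] by (intro 1)
      finally show ?case by simp
    qed (use 1 that in simp)
    \<comment> \<open>The induction runs over \<open>Suc k\<close> because the two sides agree at
      exponent 0; \<open>n - 1\<close> yields \<open>u ^^ n\<close>.\<close>
    from this[of "(x + y) / 2" "n - 1"] show False using comm n xy by simp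
  next
    case 2
    have "v ((u ^^ Suc k) t) < (u ^^ Suc k) (v t)" if "x < t \<and> t < y" for k t
    proof (induction k)
      case (Suc k)
      have "v (u ((u ^^ Suc k) t)) < u (v ((u ^^ Suc k) t))" using invn[OF that] by (intro 2)
      also have "\<dots> < u ((u ^^ Suc k) (v t))" using Suc u(1) by (simp only: strict_mono_less)
      finally show ?case by simp
    qed (use 2 that in simp)
    from this[of "(x + y) / 2" "n - 1"] show False using comm n xy by simp
  qed
qed

text \<open>The commutator \<open>c\<close> commutes with \<open>h = u ^^ n = v ^^ m\<close>, fixes
  \<open>x\<close> and, by \<open>common_power_coincidence\<close>, an interior point; Kopell's
  lemma makes it the identity between \<open>x\<close> and \<open>y\<close>.\<close>

lemma common_power_commute_contraction:
  assumes u: "bij u" "strict_mono u" "u x = x" "u y = y" "bounded_distortion x y u"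
    and v: "bij v" "strict_mono v" "bounded_distortion x y v"
    and eq: "u ^^ n = v ^^ m" and nm: "n > 0" "m > 0"
    and lt: "\<And>t. \<lbrakk>x < t; t < y\<rbrakk> \<Longrightarrow> u t < t" and t: "x < t" "t < y"
  shows "u (v t) = v (u t)"
proof -
  define h where "h = u ^^ n"
  have hu: "h (u s) = u (h s)" for s unfolding h_def by (metis comp_apply funpow.simps(2) funpow_Suc_right)
  have hv: "h (v s) = v (h s)" for s unfolding h_def eq by (metis comp_apply funpow.simps(2) funpow_Suc_right)
  have vxy: "v x = x" "v y = y"
    using strict_mono_funpow_fixed[OF v(2) _ nm(2)] funpow_fixed[of u _ n] u(3,4) eq by metis+
  have bc: "continuous_on {x..y} u" "continuous_on {x..y} v"
    using bounded_distortion_continuous u v by blast+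
  obtain p where p: "x < p" "p < y" "u (v p) = v (u p)"
    using common_power_coincidence[OF u(2) bc(1) u(3,4) v(2) bc(2) vxy _ nm(1)] hv t
    unfolding h_def by fastforce
  define w where "w = v \<circ> u"
  have w: "bij w" "strict_mono w" "w x = x" "w y = y" "bounded_distortion x y w"
    using u v vxy unfolding w_def
    by (auto intro: bij_comp strict_mono_o bounded_distortion_comp)
  have iw: "w (inv w s) = s" "inv w (w s) = s" for s
    using w(1) by (simp_all add: bij_is_surj surj_f_inv_f bij_is_inj)
  have iw': "bij (inv w)" "strict_mono (inv w)" "inv w x = x" "inv w y = y" "bounded_distortion x y (inv w)"
    using w iw bounded_distortion_inv[OF w(5,2,1)]
    by (auto simp: bij_imp_bij_inv strict_mono_inv) (metis iw(2))+
  have hw: "h (w s) = w (h s)" for s by (simp add: w_def hu hv)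
  have hiw: "h (inv w s) = inv w (h s)" for s by (metis hw iw)
  define c where "c = inv w \<circ> (u \<circ> v)"
  have "c t = t"
  proof (rule kopell[where h = h and x = x and y = y and p = p])
    show "bij h" "strict_mono h" "h x = x" "bounded_distortion x y h"
      unfolding h_def using u by (auto intro: bij_fn strict_mono_funpow funpow_fixed bounded_distortion_funpow)
    show "h s < s" if s: "x < s" "s < y" for s
    proof -
      have "x < (u ^^ k) s \<and> (u ^^ Suc k) s < s" for k
      proof (induction k)
        case (Suc k)
        then have 1: "x < u ((u ^^ k) s)" using u(2,3) by (metis strict_mono_less)
        then have "u (u ((u ^^ k) s)) < u ((u ^^ k) s)" using Suc s by (intro lt) auto
        then show ?case using Suc 1 by simp
      qed (use s lt in simp)
      from this[of "n - 1"] show ?thesis using nm by (simp add: h_def)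
    qed
    show "bij c" "strict_mono c" "c x = x" "bounded_distortion x y c"
      using u v vxy iw' unfolding c_def
      by (auto intro!: bij_comp strict_mono_o bounded_distortion_comp)
    show "c (h s) = h (c s)" for s by (simp add: c_def hiw hu hv)
    show "c p = p" using p iw by (simp add: c_def w_def)
  qed (use p t in auto)
  then have "w t = u (v t)" using iw by (metis c_def comp_apply)
  then show ?thesis by (simp add: w_def)
qed

lemma common_power_commute_component:
  assumes u: "bij u" "strict_mono u" "u x = x" "u y = y" "bounded_distortion x y u"
    and v: "bij v" "strict_mono v" "bounded_distortion x y v"
    and eq: "u ^^ n = v ^^ m" and nm: "n > 0" "m > 0"
    and ne: "\<And>t. \<lbrakk>x < t; t < y\<rbrakk> \<Longrightarrow> u t \<noteq> t" and t: "x < t" "t < y"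
  shows "u (v t) = v (u t)"
proof -
  consider "\<And>t. x < t \<and> t < y \<Longrightarrow> u t < t" | "\<And>t. x < t \<and> t < y \<Longrightarrow> t < u t"
    using continuous_no_crossing[OF bounded_distortion_continuous[OF u(5,2)] continuous_on_id] ne
    by blast
  then show ?thesis
  proof cases
    case 1
    then show ?thesis using common_power_commute_contraction[OF u v eq nm _ t] by blast
  next
    case 2
    have vxy: "v x = x" "v y = y"
      using strict_mono_funpow_fixed[OF v(2) _ nm(2)] funpow_fixed[of u _ n] u(3,4) eq by metis+
    have iu: "u (inv u s) = s" "inv u (u s) = s" and iv: "v (inv v s) = s" "inv v (v s) = s" for s
      using u(1) v(1) by (simp_all add: bij_is_surj surj_f_inv_f bij_is_inj)
    have iuxy: "inv u x = x" "inv u y = y" using iu u(3,4) by metis+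
    have inside: "x < w s \<and> w s < y" if "x < s" "s < y" "strict_mono w" "w x = x" "w y = y" for w :: "real \<Rightarrow> real" and s
      using that by (metis strict_mono_less)
    \<comment> \<open>Commuting of the inverses at \<open>v (u t)\<close> is commuting of
      \<open>u\<close> and \<open>v\<close> at \<open>t\<close>.\<close>
    define s where "s = v (u t)"
    have s: "x < s" "s < y" using inside t u v vxy by (auto simp: s_def)
    have "inv u (inv v s) = inv v (inv u s)"
    proof (rule common_power_commute_contraction[where x = x and y = y])
      show "bounded_distortion x y (inv u)" "bounded_distortion x y (inv v)"
        using bounded_distortion_inv u v vxy by metis+
      show "inv u ^^ n = inv v ^^ m" using eq u(1) v(1) by (simp flip: inv_fn)
      show "inv u r < r" if "x < r" "r < y" for r
        using 2[of "inv u r"] inside[of r "inv u"] that iuxy iu u(1,2) by (simp add: strict_mono_inv)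
    qed (use u v iuxy nm s in \<open>auto simp: bij_imp_bij_inv strict_mono_inv\<close>)
    then show ?thesis unfolding s_def by (metis iu iv)
  qed
qed

text \<open>Both \<open>u\<close> and \<open>v\<close> have the fixed points of their common power.
  For any other \<open>t\<close>, the nearest fixed points \<open>x\<close> and \<open>y\<close> on
  either side bound the component containing \<open>t\<close>.\<close>

theorem common_power_commute:
  assumes u: "bij u" "strict_mono u" "u a = a" "u b = b" "bounded_distortion a b u"
    and v: "bij v" "strict_mono v" "bounded_distortion a b v"
    and eq: "u ^^ n = v ^^ m" and nm: "n > 0" "m > 0" and t: "a \<le> t" "t \<le> b"
  shows "u (v t) = v (u t)"
proof (cases "u t = t")
  case True
  then have "v t = t" using strict_mono_funpow_fixed[OF v(2) _ nm(2)] funpow_fixed[of u t n] eq by metis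
  then show ?thesis using True by simp
next
  case False
  have iu: "u (inv u s) = s" "inv u (u s) = s" for s
    using u(1) by (simp_all add: bij_is_surj surj_f_inv_f bij_is_inj)
  have um: "u r < u s \<longleftrightarrow> r < s" "u r \<le> u s \<longleftrightarrow> r \<le> s" for r s
    using u(2) by (simp_all add: strict_mono_less strict_mono_less_eq)
  define S where "S = {s. a \<le> s \<and> s \<le> t \<and> u s = s}"
  define T where "T = {s. t \<le> s \<and> s \<le> b \<and> u s = s}"
  define x where "x = Sup S"
  define y where "y = Inf T"
  have S: "a \<in> S" "bdd_above S" and T: "b \<in> T" "bdd_below T"
    using t u by (auto simp: S_def T_def)
  have xs: "s \<le> x" if "s \<in> S" for s unfolding x_def using that S by (simp add: cSup_upper)
  have ys: "y \<le> s" if "s \<in> T" for s unfolding y_def using that T by (simp add: cInf_lower)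
  have xt: "x \<le> t" unfolding x_def using S by (intro cSup_least) (auto simp: S_def)
  have ty: "t \<le> y" unfolding y_def using T by (intro cInf_greatest) (auto simp: T_def)
  have ux: "u x = x"
  proof (rule antisym)
    show "x \<le> u x" unfolding x_def
    proof (rule cSup_least)
      fix s assume s: "s \<in> S"
      then have "u s \<le> u (Sup S)" using xs[OF s] by (simp add: um x_def)
      then show "s \<le> u (Sup S)" using s by (simp add: S_def)
    qed (use S in auto)
    show "u x \<le> x"
    proof (rule ccontr)
      assume "\<not> u x \<le> x"
      \<comment> \<open>A fixed point \<open>s\<close> of \<open>u\<close> in \<open>S\<close> then
        lies above \<open>inv u x\<close>, so \<open>x < u s = s\<close>, against the choice of
        \<open>x\<close> as supremum.\<close>
      then have "inv u x < x" using um(1)[of "inv u x" x] iu by simp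
      then obtain s where "s \<in> S" "inv u x < s" unfolding x_def using S less_cSup_iff by (metis empty_iff)
      then show False using um(1)[of "inv u x" s] iu xs[of s] by (simp add: S_def)
    qed
  qed
  have uy: "u y = y"
  proof (rule antisym)
    show "u y \<le> y" unfolding y_def
    proof (rule cInf_greatest)
      fix s assume s: "s \<in> T"
      then have "u (Inf T) \<le> u s" using ys[OF s] by (simp add: um y_def)
      then show "u (Inf T) \<le> s" using s by (simp add: T_def)
    qed (use T in auto)
    show "y \<le> u y"
    proof (rule ccontr)
      assume "\<not> y \<le> u y"
      then have "y < inv u y" using um(1)[of y "inv u y"] iu by simp
      then obtain s where "s \<in> T" "s < inv u y" unfolding y_def using T cInf_less_iff by (metis empty_iff)
      then show False using um(1)[of s "inv u y"] iu ys[of s] by (simp add: T_def)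
    qed
  qed
  have xy: "x < t" "t < y" using False ux uy xt ty by (metis order_le_less)+
  have ab: "a \<le> x" "y \<le> b" using xs ys S T by auto
  show ?thesis
  proof (rule common_power_commute_component[where x = x and y = y and n = n and m = m])
    show "u r \<noteq> r" if "x < r" "r < y" for r
      using that xs[of r] ys[of r] ab by (cases "r \<le> t") (auto simp: S_def T_def)
  qed (use u v ux uy xy ab nm eq bounded_distortion_subset in auto)
qed

section \<open>The interval\<close>

lemma funpow_conjugate:
  assumes "bij F"
  shows "((\<lambda>t. F (G (inv F t))) ^^ i) t = F ((G ^^ i) (inv F t))"
  using assms by (induction i) (simp_all add: bij_is_surj surj_f_inv_f bij_is_inj)

text \<open>A bijection of the whole line allows \<open>inv\<close> in place of
  \<open>inv_into\<close>. Smoothness may fail at 0 and 1, which is harmless because distortion is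
  controlled on \<open>{0..1}\<close> alone.\<close>

definition extend_by_id :: "(real \<Rightarrow> real) \<Rightarrow> real \<Rightarrow> real" where
  "extend_by_id f = (\<lambda>t. if t \<in> {0..1} then f t else t)"

lemma Diff2_interval_extend:
  assumes "f \<in> Diff2_interval"
  shows "bij (extend_by_id f)" "strict_mono (extend_by_id f)" "bounded_distortion 0 1 (extend_by_id f)"
    "extend_by_id f 0 = 0" "extend_by_id f 1 = 1"
proof -
  have f: "bij_betw f {0..1} {0..1}" "C2_on {0..1} f" "C2_on {0..1} (inv_into {0..1} f)" "strict_mono_on {0..1} f"
    using assms by (auto simp: Diff2_interval_def)
  have im: "f ` {0..1} = {0..1}" using f(1) by (simp add: bij_betw_def)
  have rng: "0 \<le> f t" "f t \<le> 1" if "0 \<le> t" "t \<le> 1" for t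
    using imageI[of t "{0..1}" f] that unfolding im by auto
  have "bij_betw (extend_by_id f) {0..1} {0..1}" 
    by (rule bij_betw_cong[THEN iffD2, OF _ f(1)]) (auto simp: extend_by_id_def)
  moreover have "bij_betw (extend_by_id f) (- {0..1}) (- {0..1})"
    by (rule bij_betw_cong[THEN iffD2, OF _ bij_betw_id]) (auto simp: extend_by_id_def)
  ultimately have "bij_betw (extend_by_id f) ({0..1} \<union> - {0..1}) ({0..1} \<union> - {0..1})"
    by (rule bij_betw_combine) auto
  then show "bij (extend_by_id f)" by (simp only: Compl_partition)
  show "strict_mono (extend_by_id f)"
  proof (rule strict_monoI)
    fix s t :: real assume st: "s < t"
    show "extend_by_id f s < extend_by_id f t"
      using st rng[of s] rng[of t] strict_mono_onD[OF f(4), of s t] by (auto simp: extend_by_id_def)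
  qed
  obtain g1 where g1: "\<And>x. x \<in> {0..1} \<Longrightarrow> (inv_into {0..1} f has_real_derivative g1 x) (at x within {0..1})"
    using f(3) unfolding C2_on_def by blast
  have "bounded_distortion 0 1 f"
  proof (rule C2_on_bounded_distortion[OF f(2) _ f(4)])
    show "inv_into {0..1} f (f s) = s" if "s \<in> {0..1}" for s
      using f(1) that by (simp add: bij_betw_def inv_into_f_f)
    show "\<exists>k. (inv_into {0..1} f has_real_derivative k) (at (f t) within f ` {0..1})" if "t \<in> {0..1}" for t
      unfolding im using g1[of "f t"] rng[of t] that by auto
  qed simp
  then show "bounded_distortion 0 1 (extend_by_id f)"
    by (rule bounded_distortion_cong) (simp add: extend_by_id_def)
  obtain a where a: "a \<in> {0..1}" "f a = 0" using im by (metis atLeastAtMost_iff imageE order.refl zero_le_one)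
  obtain b where b: "b \<in> {0..1}" "f b = 1" using im by (metis atLeastAtMost_iff imageE order.refl zero_le_one)
  have "f 0 \<le> f a" "f b \<le> f 1" using a(1) b(1) strict_mono_on_leD[OF f(4)] by auto
  then show "extend_by_id f 0 = 0" "extend_by_id f 1 = 1"
    using a b rng[of 0] rng[of 1] by (auto simp: extend_by_id_def)
qed

lemma no_faithful_BS_interval:
  assumes mn: "1 < m" "m < n" and f: "f \<in> Diff2_interval" and g: "g \<in> Diff2_interval"
  shows "\<not> faithful_BS m n {0..1} f g"
proof
  assume faith: "faithful_BS m n {0..1} f g"
  define F where "F = extend_by_id f"
  define G where "G = extend_by_id g"
  note F = Diff2_interval_extend[OF f, folded F_def] and G = Diff2_interval_extend[OF g, folded G_def]
  let ?h = "\<lambda>c. if c then F else G"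
  have out: "F t = t" "G t = t" if "t \<notin> {0..1}" for t using that by (auto simp: F_def G_def extend_by_id_def)
  have ev: "eval_word UNIV ?h w t = eval_word {0..1} (\<lambda>c. if c then f else g) w t" if "t \<in> {0..1}" for w t
    using eval_word_semiconj[of "\<lambda>c. if c then f else g" "{0..1}" ?h UNIV "\<lambda>t. t" t w] that f g F(1) G(1)
    by (auto simp: Diff2_interval_def F_def G_def extend_by_id_def)
  \<comment> \<open>Outside the interval every word acts trivially, so the relation holds on the
    whole line.\<close>
  have "eval_word UNIV ?h (bs_relator m n) t = t" for t
    using ev[of t] faithful_BS_relator[OF faith, of t] eval_word_fixed[of ?h t] out F(1) G(1)
    by (cases "t \<in> {0..1}") auto
  then have rel: "F ((G ^^ m) (inv F t)) = (G ^^ n) t" for t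
    using eval_bs_relator[OF F(1) G(1), of m n t] by simp
  define V where "V = (\<lambda>t. F (G (inv F t)))"
  have V: "V = F \<circ> (G \<circ> inv F)" by (auto simp: V_def)
  have iF: "bij (inv F)" "strict_mono (inv F)" "bounded_distortion 0 1 (inv F)" "inv F 0 = 0" "inv F 1 = 1"
    using F bounded_distortion_inv[OF F(3,2,1)]
    by (auto simp: bij_imp_bij_inv strict_mono_inv inv_f_eq bij_is_inj)
  have V': "bij V" "strict_mono V" "bounded_distortion 0 1 V"
    unfolding V using F G iF
    by (auto intro!: bij_comp strict_mono_o bounded_distortion_comp)
  have eq: "G ^^ n = V ^^ m"
    using funpow_conjugate[OF F(1), where G = G and i = m] rel by (auto simp: V_def)
  have "V (G t) = G (V t)" for t
  proof (cases "t \<in> {0..1}")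
    case True
    then show ?thesis
      using common_power_commute[OF G(1,2,4,5,3) V' eq, of t] mn by auto
  next
    case False
    then show ?thesis using out[OF False] F(1) by (simp add: V_def inv_f_eq bij_is_inj)
  qed
  then have "eval_word UNIV ?h (comm_word 1) t = t" for t
    by (intro eval_comm_word F G) (simp add: V_def)
  then have "bs_eq m n (comm_word 1) []"
    using faith ev unfolding faithful_BS_def by metis
  \<comment> \<open>The exponent 1 is not divisible by \<open>m > 1\<close> and is less than
    \<open>n\<close>.\<close>
  then show False using comm_word_nontrivial[of m 1 n] mn by simp
qed

section \<open>The circle\<close>

text \<open>Distortion bounds on all compact intervals replace differentiability. The class is
  closed under composition, inversion and integer translation, so the auxiliary maps stay in
  it.\<close>

definition regular_lift :: "(real \<Rightarrow> real) \<Rightarrow> bool" where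
  "regular_lift K \<longleftrightarrow> bij K \<and> strict_mono K \<and> (\<forall>t. K (t + 1) = K t + 1)
     \<and> (\<forall>a b. bounded_distortion a b K)"

lemma lift_add_int:
  fixes K :: "real \<Rightarrow> real"
  assumes "\<forall>t. K (t + 1) = K t + 1"
  shows "K (t + of_int j) = K t + of_int j"
proof (induction j rule: int_induct[where k = 0])
  case (step1 i)
  then show ?case using assms[rule_format, of "t + of_int i"] by (simp add: add.assoc)
next
  case (step2 i)
  then show ?case using assms[rule_format, of "t + of_int (i - 1)"] by simp
qed simp

lemma regular_lift_comp: "regular_lift K \<Longrightarrow> regular_lift L \<Longrightarrow> regular_lift (K \<circ> L)"
  unfolding regular_lift_def by (auto intro: bij_comp strict_mono_o bounded_distortion_comp)

lemma regular_lift_inv: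
  assumes "regular_lift K"
  shows "regular_lift (inv K)"
proof -
  have K: "bij K" "strict_mono K" "\<forall>t. K (t + 1) = K t + 1" "\<And>a b. bounded_distortion a b K"
    using assms by (auto simp: regular_lift_def)
  have i: "K (inv K t) = t" "inv K (K t) = t" for t
    using K(1) by (simp_all add: bij_is_surj surj_f_inv_f bij_is_inj)
  have "inv K (t + 1) = inv K t + 1" for t by (metis K(3) i)
  moreover have "bounded_distortion a b (inv K)" for a b
    using bounded_distortion_inv[OF K(4,2,1), of "inv K a" "inv K b"] i by simp
  ultimately show ?thesis unfolding regular_lift_def using K
    by (simp add: bij_imp_bij_inv strict_mono_inv)
qed

lemma regular_lift_funpow: "regular_lift K \<Longrightarrow> regular_lift (K ^^ k)"
proof (induction k)
  case 0
  then show ?case using bounded_distortion_id bij_id by (simp add: regular_lift_def id_def strict_mono_def)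
next
  case (Suc k)
  then show ?case unfolding funpow.simps by (intro regular_lift_comp)
qed

lemma regular_lift_translate:
  assumes "regular_lift K"
  shows "regular_lift (\<lambda>t. K t + of_int k)"
proof -
  have "bij (\<lambda>t::real. t + of_int k)" by (rule o_bij[where g = "\<lambda>t. t - of_int k"]) auto
  then have "bij ((\<lambda>t. t + of_int k) \<circ> K)" using assms by (intro bij_comp) (auto simp: regular_lift_def)
  moreover have "bounded_distortion a b (\<lambda>t. K t + of_int k)" for a b
    using assms unfolding regular_lift_def bounded_distortion_def by simp
  ultimately show ?thesis using assms unfolding regular_lift_def strict_mono_def
    by (auto simp: comp_def)
qed

lemma funpow_translate:
  fixes K :: "real \<Rightarrow> real"
  assumes "\<forall>t. K (t + 1) = K t + 1"
  shows "((\<lambda>t. K t + of_int k) ^^ i) t = (K ^^ i) t + of_int (int i * k)"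
proof (induction i)
  case (Suc i)
  have "((\<lambda>t. K t + of_int k) ^^ Suc i) t = K ((K ^^ i) t + of_int (int i * k)) + of_int k"
    by (simp only: funpow.simps comp_apply Suc.IH)
  also have "\<dots> = (K ^^ Suc i) t + of_int (int (Suc i) * k)"
    unfolding lift_add_int[OF assms] by (simp add: algebra_simps)
  finally show ?case .
qed simp

section \<open>Displacement and fixed points of lifts\<close>

lemma lift_displacement_bounded:
  fixes K :: "real \<Rightarrow> real"
  assumes K: "strict_mono K" "\<forall>t. K (t + 1) = K t + 1"
  obtains C :: int where "\<And>t. \<bar>K t - t\<bar> \<le> of_int C"
proof
  fix t :: real
  define r where "r = frac t"
  have r: "0 \<le> r" "r < 1" by (auto simp: r_def frac_lt_1)
  have t: "t = r + of_int \<lfloor>t\<rfloor>" by (simp add: r_def frac_def)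
  have "K t = K r + of_int \<lfloor>t\<rfloor>" using lift_add_int[OF K(2)] t by metis
  then have "K t - t = K r - r" using t by linarith
  moreover have "K 0 \<le> K r" "K r \<le> K 1" using r K(1) by (auto simp: strict_mono_less_eq)
  moreover have "K 1 = K 0 + 1" using K(2)[rule_format, of 0] by simp
  ultimately show "\<bar>K t - t\<bar> \<le> of_int (\<lceil>\<bar>K 0\<bar>\<rceil> + 1)" using r by (simp add: abs_le_iff) linarith
qed

text \<open>The displacement is continuous and 1-periodic, so its modulus attains a positive minimum
  over a period; having no zero, it keeps one sign.\<close>

lemma lift_displacement_gap:
  assumes H: "regular_lift H" and ne: "\<And>t. H t \<noteq> t"
  obtains \<epsilon> where "\<epsilon> > 0" "(\<forall>t. H t \<ge> t + \<epsilon>) \<or> (\<forall>t. H t \<le> t - \<epsilon>)"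
proof -
  have H': "strict_mono H" "\<forall>t. H (t + 1) = H t + 1" and cont: "continuous_on {a..b} H" for a b
    using H bounded_distortion_continuous by (auto simp: regular_lift_def)
  have per: "H t - t = H (frac t) - frac t" for t
  proof -
    have t: "t = frac t + of_int \<lfloor>t\<rfloor>" by (simp add: frac_def)
    have "H t = H (frac t) + of_int \<lfloor>t\<rfloor>" using lift_add_int[OF H'(2)] t by metis
    then show ?thesis using t by linarith
  qed
  have fr: "frac t \<in> {0..1}" for t :: real using frac_ge_0[of t] frac_lt_1[of t] by simp
  have c: "continuous_on {0..1} (\<lambda>t. \<bar>H t - t\<bar>)" by (intro continuous_intros cont)
  have "\<exists>s\<in>{0..1}. \<forall>t\<in>{0..1}. \<bar>H s - s\<bar> \<le> \<bar>H t - t\<bar>"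
    by (rule continuous_attains_inf[OF _ _ c]) auto
  then obtain s where s: "\<And>t. t \<in> {0..1} \<Longrightarrow> \<bar>H s - s\<bar> \<le> \<bar>H t - t\<bar>" by blast
  have min: "\<bar>H s - s\<bar> \<le> \<bar>H t - t\<bar>" for t using s[OF fr[of t]] per[of t] by simp
  \<comment> \<open>The period \<open>{0..1}\<close> is enlarged because
    \<open>continuous_no_crossing\<close> concerns open intervals.\<close>
  have "(\<forall>t. -1 < t \<and> t < 2 \<longrightarrow> H t < t) \<or> (\<forall>t. -1 < t \<and> t < 2 \<longrightarrow> t < H t)"
    using continuous_no_crossing[OF cont continuous_on_id, of "-1" 2] ne by blast
  moreover have "-1 < t \<and> t < 2" if "t \<in> {0..1}" for t :: real using that by auto
  ultimately consider "\<And>t. t \<in> {0..1} \<Longrightarrow> H t < t" | "\<And>t. t \<in> {0..1} \<Longrightarrow> t < H t" by blast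
  then have "(\<forall>t. H t \<ge> t + \<bar>H s - s\<bar>) \<or> (\<forall>t. H t \<le> t - \<bar>H s - s\<bar>)"
  proof cases
    case 1
    have "H t \<le> t - \<bar>H s - s\<bar>" for t using min[of t] 1[OF fr[of t]] per[of t] by linarith
    then show ?thesis by blast
  next
    case 2
    have "H t \<ge> t + \<bar>H s - s\<bar>" for t using min[of t] 2[OF fr[of t]] per[of t] by linarith
    then show ?thesis by blast
  qed
  then show thesis using that[of "\<bar>H s - s\<bar>"] ne[of s] by auto
qed

text \<open>This is the equality \<open>m \<rho> = n \<rho>\<close> of rotation numbers modulo 1, phrased without them: a
  positive displacement of \<open>G ^^ (n - m) + k\<close> would accumulate under iteration, whereas \<open>G ^^ (m * N)\<close>
  and its conjugate by \<open>F\<close> stay within bounded distance.\<close>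

lemma lift_relation_fixed_point:
  assumes F: "regular_lift F" and G: "regular_lift G" and mn: "m < n"
    and rel: "\<And>s. F ((G ^^ m) (inv F s)) = (G ^^ n) s + of_int k"
  shows "\<exists>t. (G ^^ (n - m)) t + of_int k = t"
proof (rule ccontr)
  assume "\<not> ?thesis"
  then have ne: "(G ^^ (n - m)) t + of_int k \<noteq> t" for t by blast
  define H where "H = (\<lambda>t. (G ^^ (n - m)) t + of_int k)"
  have H: "regular_lift H" unfolding H_def by (intro regular_lift_translate regular_lift_funpow G)
  obtain \<epsilon> where \<epsilon>: "\<epsilon> > 0" "(\<forall>t. H t \<ge> t + \<epsilon>) \<or> (\<forall>t. H t \<le> t - \<epsilon>)"
    using lift_displacement_gap[OF H] ne unfolding H_def by blast
  have F': "bij F" "strict_mono F" "\<forall>t. F (t + 1) = F t + 1" using F by (auto simp: regular_lift_def)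
  have iF: "F (inv F t) = t" for t using F' by (simp add: bij_is_surj surj_f_inv_f)
  obtain C :: int where C: "\<And>t. \<bar>F t - t\<bar> \<le> of_int C" using lift_displacement_bounded[OF F'(2,3)] by blast
  have Ci: "\<bar>inv F t - t\<bar> \<le> of_int C" for t using C[of "inv F t"] iF[of t] by linarith
  \<comment> \<open>Since \<open>F\<close> and its inverse displace by at most \<open>C\<close>
    each, conjugation moves \<open>P\<close> at 0 by at most \<open>2 * C\<close>; \<open>N\<close>
    steps of \<open>H\<close> must exceed this.\<close>
  obtain N where N: "real N * \<epsilon> > of_int (2 * C + 1)" using reals_Archimedean3[OF \<epsilon>(1)] by blast
  define P where "P = G ^^ (m * N)"
  have P: "regular_lift P" unfolding P_def by (intro regular_lift_funpow G)
  then have P': "strict_mono P" "\<forall>t. P (t + 1) = P t + 1" by (auto simp: regular_lift_def)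
  have Pm: "P s \<le> P t \<longleftrightarrow> s \<le> t" for s t using P'(1) by (simp add: strict_mono_less_eq)
  note Pj = lift_add_int[OF P'(2)]
  have Gt: "\<forall>t. (G ^^ i) (t + 1) = (G ^^ i) t + 1" for i
    using regular_lift_funpow[OF G] by (simp add: regular_lift_def)
  \<comment> \<open>The \<open>N\<close>-th power of the relation is \<open>G ^^ (n * N)\<close>
    translated by \<open>N * k\<close>, regrouped as \<open>P\<close> after \<open>N\<close> steps
    of \<open>H\<close>.\<close>
  have "F (P (inv F s)) = P ((H ^^ N) s)" for s
  proof -
    have "F (P (inv F s)) = ((\<lambda>t. F ((G ^^ m) (inv F t))) ^^ N) s"
      unfolding P_def using funpow_conjugate[OF F'(1), where G = "G ^^ m" and i = N] by (simp add: funpow_mult mult.commute)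
    also have "\<dots> = (G ^^ (n * N)) s + of_int (int N * k)"
      using funpow_translate[OF Gt[of n], where k = k and i = N and t = s] by (simp add: rel funpow_mult mult.commute)
    also have "n * N = m * N + (n - m) * N" using mn by (simp flip: distrib_right)
    also have "(G ^^ (m * N + (n - m) * N)) s + of_int (int N * k)
        = P ((G ^^ ((n - m) * N)) s + of_int (int N * k))"
      unfolding Pj by (simp add: P_def funpow_add)
    also have "(G ^^ ((n - m) * N)) s + of_int (int N * k) = (H ^^ N) s"
      unfolding H_def funpow_translate[OF Gt] by (simp add: funpow_mult mult.commute)
    finally show ?thesis .
  qed
  then have FP: "F (P (inv F 0)) = P ((H ^^ N) 0)" .
  have up: "F (P (inv F 0)) \<le> P 0 + of_int (2 * C)" and lo: "F (P (inv F 0)) \<ge> P 0 - of_int (2 * C)"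
    using C[of "P (inv F 0)"] Ci[of 0] Pm[of "inv F 0" "0 + of_int C"] Pm[of "0 + of_int (- C)" "inv F 0"]
      Pj[of 0 C] Pj[of 0 "- C"] by (auto simp: abs_le_iff)
  from \<epsilon>(2) show False
  proof
    assume h: "\<forall>t. H t \<ge> t + \<epsilon>"
    have "(H ^^ i) 0 \<ge> real i * \<epsilon>" for i
    proof (induction i)
      case (Suc i)
      then show ?case using h[rule_format, of "(H ^^ i) 0"] by (simp add: algebra_simps)
    qed simp
    then have "0 + of_int (2 * C + 1) \<le> (H ^^ N) 0" using N by (metis add_0 less_imp_le order_trans)
    then have "P (0 + of_int (2 * C + 1)) \<le> P ((H ^^ N) 0)" by (simp only: Pm)
    then show False using up unfolding Pj FP by simp
  next
    assume h: "\<forall>t. H t \<le> t - \<epsilon>"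
    have "(H ^^ i) 0 \<le> - (real i * \<epsilon>)" for i
    proof (induction i)
      case (Suc i)
      then show ?case using h[rule_format, of "(H ^^ i) 0"] by (simp add: algebra_simps)
    qed simp
    from this[of N] have "(H ^^ N) 0 \<le> 0 + of_int (- (2 * C + 1))" using N by simp
    then have "P ((H ^^ N) 0) \<le> P (0 + of_int (- (2 * C + 1)))" by (simp only: Pm)
    then show False using lo unfolding Pj FP by simp
  qed
qed

text \<open>The translated power \<open>H\<close> has fixed points, and its conjugate
  \<open>L\<close> satisfies \<open>L ^^ m = H ^^ n\<close>: the translations
  \<open>(n - m) * k\<close> from the relation and \<open>m * k\<close> from the factors of
  \<open>L\<close> add up to \<open>n * k\<close>. Integer translations commute with lifts, so
  commuting passes from \<open>H\<close> and \<open>L\<close> to \<open>U\<close> and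
  \<open>V\<close>.\<close>

lemma lift_relation_commute:
  assumes F: "regular_lift F" and G: "regular_lift G" and m: "0 < m" and mn: "m < n"
    and rel: "\<And>s. F ((G ^^ m) (inv F s)) = (G ^^ n) s + of_int k"
  defines "U \<equiv> G ^^ (n - m)"
  defines "V \<equiv> \<lambda>t. F (U (inv F t))"
  shows "U (V t) = V (U t)"
proof -
  define H where "H = (\<lambda>t. U t + of_int k)"
  define L where "L = (\<lambda>t. F (H (inv F t)))"
  have Gt: "\<forall>t. (G ^^ i) (t + 1) = (G ^^ i) t + 1" for i
    using regular_lift_funpow[OF G] by (simp add: regular_lift_def)
  have H: "regular_lift H" unfolding H_def U_def by (intro regular_lift_translate regular_lift_funpow G)
  have "regular_lift (F \<circ> (H \<circ> inv F))" by (intro regular_lift_comp regular_lift_inv F H)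
  then have L: "regular_lift L" by (simp add: L_def comp_def)
  have F': "bij F" "\<forall>t. F (t + 1) = F t + 1" using F by (auto simp: regular_lift_def)
  note Fj = lift_add_int[OF F'(2)]
  have LV: "L t = V t + of_int k" for t by (simp add: L_def V_def H_def Fj)
  have Vt: "\<forall>t. V (t + 1) = V t + 1"
  proof -
    have "regular_lift (F \<circ> (U \<circ> inv F))" unfolding U_def
      by (intro regular_lift_comp regular_lift_inv regular_lift_funpow F G)
    then show ?thesis by (simp add: regular_lift_def V_def)
  qed
  have "(L ^^ m) t = (H ^^ n) t" for t
  proof -
    have "(L ^^ m) t = F ((H ^^ m) (inv F t))" unfolding L_def by (rule funpow_conjugate[OF F'(1)])
    also have "\<dots> = F ((U ^^ m) (inv F t)) + of_int (int m * k)"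
      unfolding H_def U_def funpow_translate[OF Gt] Fj ..
    also have "F ((U ^^ m) (inv F t)) = F (((G ^^ m) ^^ (n - m)) (inv F t))"
      unfolding U_def by (simp add: funpow_mult mult.commute)
    also have "\<dots> = ((\<lambda>t. F ((G ^^ m) (inv F t))) ^^ (n - m)) t" by (rule funpow_conjugate[OF F'(1), symmetric])
    also have "\<dots> = ((G ^^ n) ^^ (n - m)) t + of_int (int (n - m) * k)"
      unfolding rel funpow_translate[OF Gt] ..
    also have "(G ^^ n) ^^ (n - m) = U ^^ n" unfolding U_def by (simp add: funpow_mult mult.commute)
    also have "(U ^^ n) t + of_int (int (n - m) * k) + of_int (int m * k) = (U ^^ n) t + of_int (int n * k)"
      using mn by (simp add: of_nat_diff algebra_simps)
    also have "\<dots> = (H ^^ n) t" unfolding H_def U_def funpow_translate[OF Gt] ..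
    finally show ?thesis .
  qed
  then have eq: "H ^^ n = L ^^ m" by auto
  obtain t0 where "H t0 = t0" using lift_relation_fixed_point[OF F G mn rel] unfolding H_def U_def by blast
  then have fp: "H (t0 + of_int j) = t0 + of_int j" for j
    using lift_add_int[of H t0 j] H by (simp add: regular_lift_def)
  \<comment> \<open>Fixed points of \<open>H\<close> are invariant under integer translation, so two
    of them enclose \<open>t\<close>.\<close>
  obtain j where j: "\<bar>t - t0\<bar> \<le> of_int j" using ex_le_of_int by blast
  have "H (L t) = L (H t)"
  proof (rule common_power_commute[where u = H and v = L and a = "t0 + of_int (- j)" and b = "t0 + of_int j"])
    show "H ^^ n = L ^^ m" by (rule eq)
    show "0 < n" using mn by simp
  qed (use fp[of "- j"] fp[of j] H L j m in \<open>auto simp: regular_lift_def abs_le_iff\<close>)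
  then show ?thesis
    unfolding LV H_def using lift_add_int[OF Vt, of "U t" k] lift_add_int[of U "V t" k] Gt
    by (simp add: U_def)
qed

section \<open>Passing between the circle and the line\<close>

text \<open>Monotonicity replaces continuity: for \<open>r\<close> strictly between 0 and 1,
  \<open>R r\<close> lies in the unit interval starting at \<open>k = R 0\<close>, so the integer
  \<open>R r - r\<close> lies strictly between \<open>k - 1\<close> and
  \<open>k + 1\<close>.\<close>

lemma integer_displacement_constant:
  fixes R :: "real \<Rightarrow> real"
  assumes R: "strict_mono R" "\<forall>t. R (t + 1) = R t + 1" and Z: "\<And>t. R t - t \<in> \<int>"
  obtains k :: int where "\<And>t. R t = t + of_int k"
proof -
  obtain k :: int where k: "R 0 = of_int k" using Z[of 0] by (auto elim: Ints_cases)
  have "R t = t + of_int k" for t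
  proof -
    obtain j :: int where j: "R (frac t) - frac t = of_int j" using Z[of "frac t"] by (auto elim: Ints_cases)
    have fr: "0 \<le> frac t" "frac t < 1" by (auto simp: frac_lt_1)
    have "R 0 \<le> R (frac t)" "R (frac t) < R 1" using R(1) fr by (auto simp: strict_mono_less strict_mono_less_eq)
    moreover have "R 1 = R 0 + 1" using R(2)[rule_format, of 0] by simp
    ultimately have "of_int k < of_int j + (1::real)" "of_int j < of_int k + (1::real)" if "frac t > 0"
      using k j fr that by linarith+
    moreover have "j = k" if "frac t = 0" using j k unfolding that by simp
    ultimately have "j = k" using fr by (cases "frac t = 0") auto
    then have "R (frac t) = frac t + of_int k" using j by simp
    then have "R (frac t + of_int \<lfloor>t\<rfloor>) = frac t + of_int \<lfloor>t\<rfloor> + of_int k" unfolding lift_add_int[OF R(2)] by simp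
    then show ?thesis by (simp add: frac_def)
  qed
  then show thesis using that by blast
qed

lemma Diff2_circle_lift:
  assumes "h \<in> Diff2_circle"
  obtains H where "regular_lift H" "bij_betw h circle circle"
    "\<And>t. h (cis (2 * pi * t)) = cis (2 * pi * H t)"
proof -
  obtain F G where h: "bij_betw h circle circle" and C2: "C2_on UNIV F" "C2_on UNIV G"
    and inv: "\<And>t. G (F t) = t" "\<And>t. F (G t) = t"
    and F: "strict_mono F" "\<And>t. F (t + 1) = F t + 1" "\<And>t. h (cis (2 * pi * t)) = cis (2 * pi * F t)"
    using assms unfolding Diff2_circle_def by blast
  obtain g1 where g1: "\<And>x. (G has_real_derivative g1 x) (at x)"
    using C2(2) unfolding C2_on_def by auto
  obtain f1 f2 where f1: "\<And>x. (F has_real_derivative f1 x) (at x)" "\<And>x. (f1 has_real_derivative f2 x) (at x)"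
    "continuous_on UNIV f2"
    using C2(1) unfolding C2_on_def by auto
  have "bounded_distortion a b F" for a b
  proof (cases "a < b")
    case True
    show ?thesis
    proof (rule C2_on_bounded_distortion[OF _ True])
      show "C2_on {a..b} F"
        unfolding C2_on_def using f1
        by (intro exI[of _ f1] exI[of _ f2]) (auto intro: has_field_derivative_at_within continuous_on_subset)
      show "strict_mono_on {a..b} F" using F(1) by (auto simp: strict_mono_def intro!: strict_mono_onI)
      show "\<exists>k. (G has_real_derivative k) (at (F t) within F ` {a..b})" for t
        using g1 by (blast intro: has_field_derivative_at_within)
    qed (use inv in simp)
  next
    case False
    then show ?thesis unfolding bounded_distortion_def by (intro exI[of _ 0]) auto
  qed
  moreover have "bij F" by (rule o_bij[where g = G]) (auto simp: inv)
  ultimately have "regular_lift F" using F by (simp add: regular_lift_def)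
  then show thesis using that h F(3) by blast
qed

lemma cis_2pi_eq_iff: "cis (2 * pi * s) = cis (2 * pi * t) \<longleftrightarrow> s - t \<in> \<int>"
proof -
  have "cis (2 * pi * s) = cis (2 * pi * t) \<longleftrightarrow> cis (2 * pi * (s - t)) = 1"
    by (simp add: right_diff_distrib flip: cis_divide)
  also have "\<dots> \<longleftrightarrow> (\<exists>k::int. 2 * pi * (s - t) = of_int k * (2 * pi))"
    by (simp add: cis_conv_exp exp_eq_1 mult_ac)
  also have "\<dots> \<longleftrightarrow> (\<exists>k::int. s - t = of_int k)"
    by (intro ex_cong1) (simp add: mult.commute)
  finally show ?thesis by (auto simp: Ints_def)
qed

lemma circle_eq_cis: "z \<in> circle \<longleftrightarrow> (\<exists>t. z = cis (2 * pi * t))"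
proof
  assume "z \<in> circle"
  then have "z = cis (2 * pi * (Arg z / (2 * pi)))"
    using rcis_cmod_Arg[of z] by (simp add: circle_def rcis_def)
  then show "\<exists>t. z = cis (2 * pi * t)" by blast
qed (auto simp: circle_def)

lemma no_faithful_BS_circle:
  assumes mn: "1 < m" "m < n" "\<not> m dvd n" and f: "f \<in> Diff2_circle" and g: "g \<in> Diff2_circle"
  shows "\<not> faithful_BS m n circle f g"
proof
  assume faith: "faithful_BS m n circle f g"
  obtain F where F: "regular_lift F" "bij_betw f circle circle" "\<And>t. f (cis (2 * pi * t)) = cis (2 * pi * F t)"
    using Diff2_circle_lift[OF f] by blast
  obtain G where G: "regular_lift G" "bij_betw g circle circle" "\<And>t. g (cis (2 * pi * t)) = cis (2 * pi * G t)"
    using Diff2_circle_lift[OF g] by blast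
  let ?h = "\<lambda>c. if c then F else G"
  have h: "bij (?h c)" "strict_mono (?h c)" "?h c (t + 1) = ?h c t + 1" for c t
    using F(1) G(1) by (auto simp: regular_lift_def)
  have FG: "bij F" "bij G" using F(1) G(1) by (auto simp: regular_lift_def)
  have ev: "eval_word circle (\<lambda>c. if c then f else g) w (cis (2 * pi * t)) = cis (2 * pi * eval_word UNIV ?h w t)" for w t
    by (rule conjunct2[OF eval_word_semiconj[where \<pi> = "\<lambda>t. cis (2 * pi * t)" and Y = UNIV]])
      (use h F G in \<open>auto simp: circle_eq_cis\<close>)
  define R where "R = eval_word UNIV ?h (bs_relator m n)"
  have R: "strict_mono R" unfolding R_def by (rule eval_word_strict_mono[OF h(1,2)])
  have R1: "\<forall>t. R (t + 1) = R t + 1"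
    using eval_word_semiconj[of ?h UNIV ?h UNIV "\<lambda>t. t + 1" _ "bs_relator m n"] h unfolding R_def by auto
  have "R t - t \<in> \<int>" for t
    using faithful_BS_relator[OF faith, of "cis (2 * pi * t)"] ev[of "bs_relator m n" t]
    by (metis R_def cis_2pi_eq_iff circle_eq_cis)
  then obtain k :: int where k: "\<And>t. R t = t + of_int k"
    using integer_displacement_constant[OF R R1] by blast
  have rel: "F ((G ^^ m) (inv F s)) = (G ^^ n) s + of_int k" for s
    using eval_bs_relator[OF FG, of m n s] k unfolding R_def by simp
  \<comment> \<open>Although the relator lifts to a translation, this commutator lifts to the
    identity itself.\<close>
  have "eval_word UNIV ?h (comm_word (n - m)) t = t" for t
    using lift_relation_commute[OF F(1) G(1) _ mn(2) rel] mn by (intro eval_comm_word FG) simp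
  then have "eval_word circle (\<lambda>c. if c then f else g) (comm_word (n - m)) z = z" if "z \<in> circle" for z
    using that ev by (auto simp: circle_eq_cis)
  then have "bs_eq m n (comm_word (n - m)) []" using faith unfolding faithful_BS_def by blast
  \<comment> \<open>Here the hypothesis that \<open>m\<close> does not divide \<open>n\<close>
    enters.\<close>
  moreover have "\<not> m dvd n - m" using mn by (metis dvd_diffD dvd_refl less_imp_le)
  ultimately show False using comm_word_nontrivial[of m "n - m" n] mn by simp
qed

theorem theorem1p6:
  fixes m n :: nat
  assumes "1 < m" and "m < n"
  shows "\<not> (\<exists>f\<in>Diff2_interval. \<exists>g\<in>Diff2_interval. faithful_BS m n {0..1} f g)
         \<and> (\<not> m dvd n \<longrightarrow>
           \<not> (\<exists>f\<in>Diff2_circle. \<exists>g\<in>Diff2_circle. faithful_BS m n circle f g))"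
  using no_faithful_BS_interval no_faithful_BS_circle assms by blast

end
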